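(* Let $N\ge 3$ and $m\ge 0$ be integers, put $n=\tfrac{N(N-1)}{2}+m$, and let $G/H$ be a coset manifold embedded in $Usp(n,n)$ by $\rho$ as described in the context. Let $L(\phi)$ be a smooth local coset representative of $G/H$, let $U=\rho(L)$, and let $f,h$ (complex $n\times n$ matrix functions of $\phi$), the matrix one-form $\Gamma=U^{-1}dU=\begin{pmatrix}\omega&\bar{\mathcal P}\\ \mathcal P&\bar\omega\end{pmatrix}$, and the covariant derivative $\nabla V=dV-V\omega$ be as in the context. Then $d\Gamma+\Gamma\wedge\Gamma=0$, and $$\nabla f=\bar f\,\mathcal P,\qquad \nabla h=\bar h\,\mathcal P .$$ Consequently, for all constant real vectors $g=(g^\Lambda)$, $e=(e_\Lambda)\in\mathbb R^n$, the charges $$Z_{AB}=h_{\Lambda AB}\,g^\Lambda-f^\Lambda_{AB}\,e_\Lambda,\qquad Z_I=h_{\Lambda I}\,g^\Lambda-f^\Lambda_I\,e_\Lambda$$ satisfy $$\nabla Z_{AB}=\sum_{I}\bar Z^I P_{I\,AB}+\tfrac12\sum_{C,D}\bar Z^{CD}P_{ABCD},\qquad \nabla Z_I=\tfrac12\sum_{A,B}\bar Z^{AB}P_{AB\,I}+\sum_J\bar Z^JP_{JI},$$ where $\bar Z^{AB}=(Z_{AB})^*$, $\bar Z^I=(Z_I)^*$, and $P_{ABCD},P_{AB\,I},P_{I\,AB},P_{IJ}$ are the blocks of the matrix of one-forms $\mathcal P$.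
   Context: $Usp(n,n)=Sp(2n,\mathbb C)\cap U(n,n)$ is realized as the set of matrices $U=\mathcal A^{-1}S\mathcal A$ with $S=\begin{pmatrix}A&B\\ C&D\end{pmatrix}\in Sp(2n,\mathbb R)$ (i.e. $A^tC-C^tA=0$, $B^tD-D^tB=0$, $A^tD-C^tB=\mathbf 1$) and $\mathcal A=\begin{pmatrix}\mathbf 1&\mathbf 1\\-i\mathbf 1&i\mathbf 1\end{pmatrix}$. With $f=\tfrac1{\sqrt2}(A-iB)$ and $h=\tfrac1{\sqrt2}(C-iD)$ one has $$U=\frac1{\sqrt2}\begin{pmatrix}f+ih&\bar f+i\bar h\\ f-ih&\bar f-i\bar h\end{pmatrix}.$$ Here $G$ is a Lie group with closed subgroup $H$, with Lie algebra decomposition $\mathfrak g=\mathfrak h\oplus\mathfrak k$, $[\mathfrak h,\mathfrak h]\subset\mathfrak h$, $[\mathfrak h,\mathfrak k]\subset\mathfrak k$, $[\mathfrak k,\mathfrak k]\subset\mathfrak h$. The embedding $\rho:G\to Usp(n,n)$ is a Lie group homomorphism whose differential sends $\mathfrak h$ to block-diagonal matrices $\begin{pmatrix}\omega&0\\0&\bar\omega\end{pmatrix}$ and $\mathfrak k$ to block off-diagonal matrices $\begin{pmatrix}0&\bar{\mathcal P}\\ \mathcal P&0\end{pmatrix}$ ($n\times n$ blocks). For a local coset representative $L(\phi)\in G$ (a smooth local section of $G\to G/H$), put $U=\rho(L)$; the one-form $\Gamma=U^{-1}dU$ then has the block form in the claim, $\omega$ being the embedded $H$-connection and $\mathcal P$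 the embedded vielbein of $G/H$. The rows of $f$ and $h$ are labelled by $\Lambda=1,\dots,n$. The columns are labelled by the antisymmetric pairs $AB$ with $A,B=1,\dots,N$ (independent columns $A<B$) and by $I=1,\dots,m$, so that $f=(f^\Lambda_{AB},f^\Lambda_I)$, $h=(h_{\Lambda AB},h_{\Lambda I})$, all extended antisymmetrically in $A,B$. Accordingly $\mathcal P=\begin{pmatrix}P_{ABCD}&P_{AB\,J}\\P_{I\,CD}&P_{IJ}\end{pmatrix}$, with entries antisymmetric in each pair $AB$, $CD$. The factors $\tfrac12$ in the claim compensate for summing over all ordered pairs. $\omega$ is taken block-diagonal with respect to the splitting into the indices $AB$ and $I$. For a row vector $V=(V_{AB},V_I)$ (or a matrix whose columns are so labelled), $\nabla V=dV-V\omega$. Repeated indices $\Lambda$ are summed from $1$ to $n$. An overbar denotes complex conjugation. *)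

theory Defs
  imports "HOL-Analysis.Analysis" "HOL-Algebra.Left_Coset"
begin

section \<open>Smooth manifolds\<close>

text \<open>
  On an open subset of a finite-dimensional space, \<open>f\<close> is \<open>C\<^sup>k\<^sup>+\<^sup>1\<close> iff it is differentiable
  and all its directional derivatives are \<open>C\<^sup>k\<close>.
\<close>

fun Ck_on :: "nat \<Rightarrow> 'a::real_normed_vector set \<Rightarrow> ('a \<Rightarrow> 'b::real_normed_vector) \<Rightarrow> bool" where
  "Ck_on 0 S f \<longleftrightarrow> continuous_on S f"
| "Ck_on (Suc k) S f \<longleftrightarrow>
     (\<forall>x\<in>S. f differentiable (at x)) \<and>
     (\<forall>v. Ck_on k S (\<lambda>x. frechet_derivative f (at x) v))"

definition smooth_on :: "'a::real_normed_vector set \<Rightarrow> ('a \<Rightarrow> 'b::real_normed_vector) \<Rightarrow> bool" where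
  "smooth_on S f \<longleftrightarrow> (\<forall>k. Ck_on k S f)"

text \<open>
  \<open>'e\<close> is a finite-dimensional Euclidean space. The class \<open>euclidean_space\<close> is not used, because
  it excludes dimension \<open>0\<close>, which does occur (for \<open>N = 3\<close>, \<open>m = 0\<close> there are no scalars).
\<close>

definition euclidean_model :: "'e::real_inner itself \<Rightarrow> bool" where
  "euclidean_model (_ :: 'e itself) \<longleftrightarrow>
     (\<exists>B::'e set. finite B \<and> (\<forall>b\<in>B. \<forall>c\<in>B. inner b c = (if b = c then 1 else 0)) \<and> span B = UNIV)"

text \<open>A chart is a pair of an open domain and a coordinate map.\<close>

type_synonym ('g, 'e) atlas = "('g set \<times> ('g \<Rightarrow> 'e)) set"

definition smooth_manifold :: "'g topology \<Rightarrow> ('g, 'e::real_inner) atlas \<Rightarrow> bool" where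
  "smooth_manifold T \<A> \<longleftrightarrow>
     euclidean_model TYPE('e) \<and> Hausdorff_space T \<and> second_countable T \<and>
     (\<Union>(D, x)\<in>\<A>. D) = topspace T \<and>
     (\<forall>(D, x)\<in>\<A>. openin T D \<and> open (x ` D) \<and>
        homeomorphic_map (subtopology T D) (top_of_set (x ` D)) x) \<and>
     (\<forall>(D, x)\<in>\<A>. \<forall>(E, y)\<in>\<A>. smooth_on (x ` (D \<inter> E)) (y \<circ> inv_into D x))"

definition prod_atlas ::
  "('g, 'e) atlas \<Rightarrow> ('g', 'e') atlas \<Rightarrow> ('g \<times> 'g', 'e \<times> 'e') atlas" where
  "prod_atlas \<A> \<A>' = {(D \<times> E, map_prod x y) | D x E y. (D, x) \<in> \<A> \<and> (E, y) \<in> \<A>'}"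

text \<open>The standard atlas of a vector space.\<close>

definition std_atlas :: "('e, 'e) atlas" where
  "std_atlas = {(UNIV, id)}"

text \<open>Smooth maps from an open subset \<open>V\<close> of one manifold to another.\<close>

definition smooth_map ::
  "'g topology \<Rightarrow> ('g, 'e::real_normed_vector) atlas \<Rightarrow> 'g set \<Rightarrow>
   'k topology \<Rightarrow> ('k, 'f::real_normed_vector) atlas \<Rightarrow> ('g \<Rightarrow> 'k) \<Rightarrow> bool" where
  "smooth_map T \<A> V T' \<A>' f \<longleftrightarrow>
     openin T V \<and> continuous_map (subtopology T V) T' f \<and>
     (\<forall>(D, x)\<in>\<A>. \<forall>(E, y)\<in>\<A>'.
        smooth_on (x ` (D \<inter> V \<inter> f -` E)) (y \<circ> f \<circ> inv_into D x))"

abbreviation smooth_to_vec ::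
  "'g topology \<Rightarrow> ('g, 'e::real_normed_vector) atlas \<Rightarrow> 'g set \<Rightarrow> ('g \<Rightarrow> 'f::real_normed_vector) \<Rightarrow> bool" where
  "smooth_to_vec T \<A> V f \<equiv> smooth_map T \<A> V euclidean std_atlas f"

abbreviation smooth_from_vec ::
  "'f::real_normed_vector set \<Rightarrow> 'g topology \<Rightarrow> ('g, 'e::real_normed_vector) atlas \<Rightarrow> ('f \<Rightarrow> 'g) \<Rightarrow> bool" where
  "smooth_from_vec W T \<A> c \<equiv> smooth_map euclidean std_atlas W T \<A> c"


section \<open>Lie groups and their Lie algebras\<close>

definition lie_group :: "('g, 'b) monoid_scheme \<Rightarrow> 'g topology \<Rightarrow> ('g, 'e::real_inner) atlas \<Rightarrow> bool" where
  "lie_group G T \<A> \<longleftrightarrow>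
     group G \<and> topspace T = carrier G \<and> smooth_manifold T \<A> \<and>
     smooth_map (prod_topology T T) (prod_atlas \<A> \<A>) (carrier G \<times> carrier G) T \<A>
       (\<lambda>(a, b). a \<otimes>\<^bsub>G\<^esub> b) \<and>
     smooth_map T \<A> (carrier G) T \<A> (\<lambda>a. inv\<^bsub>G\<^esub> a)"

definition smooth_functions :: "'g topology \<Rightarrow> ('g, 'e::real_normed_vector) atlas \<Rightarrow> ('g \<Rightarrow> real) set" where
  "smooth_functions T \<A> = {f. smooth_to_vec T \<A> (topspace T) f}"

text \<open>
  The Lie algebra is the tangent space at the unit element, i.e.\ the space of point derivations
  of \<open>C\<^sup>\<infinity>(G)\<close> there. Functionals are \<open>0\<close> outside \<open>C\<^sup>\<infinity>(G)\<close>, so that equal tangent vectors are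
  equal as HOL functions.
\<close>

definition lie_algebra ::
  "('g, 'b) monoid_scheme \<Rightarrow> 'g topology \<Rightarrow> ('g, 'e::real_normed_vector) atlas \<Rightarrow> (('g \<Rightarrow> real) \<Rightarrow> real) set" where
  "lie_algebra G T \<A> = {v.
     (\<forall>f. f \<notin> smooth_functions T \<A> \<longrightarrow> v f = 0) \<and>
     (\<forall>f\<in>smooth_functions T \<A>. \<forall>g\<in>smooth_functions T \<A>.
        v (\<lambda>a. f a + g a) = v f + v g \<and>
        v (\<lambda>a. f a * g a) = v f * g \<one>\<^bsub>G\<^esub> + f \<one>\<^bsub>G\<^esub> * v g) \<and>
     (\<forall>f\<in>smooth_functions T \<A>. \<forall>c. v (\<lambda>a. c * f a) = c * v f)}"

text \<open>
  The left-invariant vector field generated by \<open>v\<close> maps \<open>f\<close> to \<open>\<lambda>a. v (\<lambda>b. f (a \<otimes> b))\<close>; the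
  bracket is the commutator of these vector fields, evaluated at the unit element.
\<close>

definition left_invariant_field ::
  "('g, 'b) monoid_scheme \<Rightarrow> (('g \<Rightarrow> real) \<Rightarrow> real) \<Rightarrow> ('g \<Rightarrow> real) \<Rightarrow> ('g \<Rightarrow> real)" where
  "left_invariant_field G v f = (\<lambda>a. v (\<lambda>b. f (a \<otimes>\<^bsub>G\<^esub> b)))"

definition lie_bracket ::
  "('g, 'b) monoid_scheme \<Rightarrow> 'g topology \<Rightarrow> ('g, 'e::real_normed_vector) atlas \<Rightarrow>
   (('g \<Rightarrow> real) \<Rightarrow> real) \<Rightarrow> (('g \<Rightarrow> real) \<Rightarrow> real) \<Rightarrow> (('g \<Rightarrow> real) \<Rightarrow> real)" where
  "lie_bracket G T \<A> v w = (\<lambda>f. if f \<in> smooth_functions T \<A>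
     then left_invariant_field G v (left_invariant_field G w f) \<one>\<^bsub>G\<^esub>
        - left_invariant_field G w (left_invariant_field G v f) \<one>\<^bsub>G\<^esub>
     else 0)"

text \<open>The Lie algebra of a closed subgroup: generators of one-parameter subgroups lying in it.\<close>

definition lie_subalgebra ::
  "('g, 'b) monoid_scheme \<Rightarrow> 'g topology \<Rightarrow> ('g, 'e::real_normed_vector) atlas \<Rightarrow> 'g set \<Rightarrow>
   (('g \<Rightarrow> real) \<Rightarrow> real) set" where
  "lie_subalgebra G T \<A> H = {v \<in> lie_algebra G T \<A>.
     \<exists>\<gamma>::real \<Rightarrow> 'g. smooth_from_vec UNIV T \<A> \<gamma> \<and>
       (\<forall>s t. \<gamma> (s + t) = \<gamma> s \<otimes>\<^bsub>G\<^esub> \<gamma> t) \<and> (\<forall>t. \<gamma> t \<in> H) \<and>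
       (\<forall>f\<in>smooth_functions T \<A>. ((\<lambda>t. f (\<gamma> t)) has_real_derivative v f) (at 0))}"

text \<open>\<open>\<gg> = \<hh> \<oplus> \<kk>\<close> with \<open>[\<hh>,\<hh>] \<subseteq> \<hh>\<close>, \<open>[\<hh>,\<kk>] \<subseteq> \<kk>\<close>, \<open>[\<kk>,\<kk>] \<subseteq> \<hh>\<close>.\<close>

definition symmetric_decomposition ::
  "('g, 'b) monoid_scheme \<Rightarrow> 'g topology \<Rightarrow> ('g, 'e::real_normed_vector) atlas \<Rightarrow> 'g set \<Rightarrow>
   (('g \<Rightarrow> real) \<Rightarrow> real) set \<Rightarrow> bool" where
  "symmetric_decomposition G T \<A> H \<kk> \<longleftrightarrow>
     (let \<gg> = lie_algebra G T \<A>; \<hh> = lie_subalgebra G T \<A> H; br = lie_bracket G T \<A> in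
      \<kk> \<subseteq> \<gg> \<and>
      (\<forall>v\<in>\<kk>. \<forall>w\<in>\<kk>. \<forall>c. (\<lambda>f. v f + w f) \<in> \<kk> \<and> (\<lambda>f. c * v f) \<in> \<kk>) \<and>
      \<gg> = {(\<lambda>f. v f + w f) | v w. v \<in> \<hh> \<and> w \<in> \<kk>} \<and> \<hh> \<inter> \<kk> = {\<lambda>f. 0} \<and>
      (\<forall>v\<in>\<hh>. \<forall>w\<in>\<hh>. br v w \<in> \<hh>) \<and>
      (\<forall>v\<in>\<hh>. \<forall>w\<in>\<kk>. br v w \<in> \<kk>) \<and>
      (\<forall>v\<in>\<kk>. \<forall>w\<in>\<kk>. br v w \<in> \<hh>))"


section \<open>The group \<open>Usp(n,n)\<close>\<close>

definition block_mat ::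
  "'a^'n^'n \<Rightarrow> 'a^'n^'n \<Rightarrow> 'a^'n^'n \<Rightarrow> 'a^'n^'n \<Rightarrow> 'a^('n + 'n)^('n + 'n)" where
  "block_mat A B C D = (\<chi> i j.
     case i of
       Inl a \<Rightarrow> (case j of Inl b \<Rightarrow> A $ a $ b | Inr b \<Rightarrow> B $ a $ b)
     | Inr a \<Rightarrow> (case j of Inl b \<Rightarrow> C $ a $ b | Inr b \<Rightarrow> D $ a $ b))"

definition block11 :: "'a^('n + 'n)^('n + 'n) \<Rightarrow> 'a^'n^'n" where
  "block11 M = (\<chi> a b. M $ Inl a $ Inl b)"
definition block12 :: "'a^('n + 'n)^('n + 'n) \<Rightarrow> 'a^'n^'n" where
  "block12 M = (\<chi> a b. M $ Inl a $ Inr b)"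
definition block21 :: "'a^('n + 'n)^('n + 'n) \<Rightarrow> 'a^'n^'n" where
  "block21 M = (\<chi> a b. M $ Inr a $ Inl b)"
definition block22 :: "'a^('n + 'n)^('n + 'n) \<Rightarrow> 'a^'n^'n" where
  "block22 M = (\<chi> a b. M $ Inr a $ Inr b)"

definition real_symplectic :: "(real^('n::finite + 'n)^('n + 'n)) set" where
  "real_symplectic = {block_mat A B C D | A B C D.
     transpose A ** C - transpose C ** A = 0 \<and>
     transpose B ** D - transpose D ** B = 0 \<and>
     transpose A ** D - transpose C ** B = mat 1}"

definition cayley :: "complex^('n::finite + 'n)^('n + 'n)" where
  "cayley = block_mat (mat 1) (mat 1) (mat (- \<i>)) (mat \<i>)"

definition Usp :: "(complex^('n::finite + 'n)^('n + 'n)) set" where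
  "Usp = {matrix_inv cayley ** map_matrix complex_of_real S ** cayley | S. S \<in> real_symplectic}"

definition Usp_group :: "(complex^('n::finite + 'n)^('n + 'n)) monoid" where
  "Usp_group = \<lparr>carrier = Usp, mult = (**), one = mat 1\<rparr>"

definition symplectic_of :: "complex^('n::finite + 'n)^('n + 'n) \<Rightarrow> complex^('n + 'n)^('n + 'n)" where
  "symplectic_of U = cayley ** U ** matrix_inv cayley"

text \<open>\<open>f = (A - \<i> B) / \<surd>2\<close> and \<open>h = (C - \<i> D) / \<surd>2\<close>.\<close>

definition f_of :: "complex^('n::finite + 'n)^('n + 'n) \<Rightarrow> complex^'n^'n" where
  "f_of U = (\<chi> \<Lambda> c. (block11 (symplectic_of U) $ \<Lambda> $ c - \<i> * block12 (symplectic_of U) $ \<Lambda> $ c)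
                        / complex_of_real (sqrt 2))"

definition h_of :: "complex^('n::finite + 'n)^('n + 'n) \<Rightarrow> complex^'n^'n" where
  "h_of U = (\<chi> \<Lambda> c. (block21 (symplectic_of U) $ \<Lambda> $ c - \<i> * block22 (symplectic_of U) $ \<Lambda> $ c)
                        / complex_of_real (sqrt 2))"


text \<open>Consistency of \<open>f_of\<close> and \<open>h_of\<close> with the parametrization of \<open>U\<close> by \<open>f\<close> and \<open>h\<close>.\<close>

lemma block_mat_mult:
  fixes A B C D A' B' C' D' :: "complex^'n::finite^'n"
  shows "block_mat A B C D ** block_mat A' B' C' D' =
    block_mat (A ** A' + B ** C') (A ** B' + B ** D') (C ** A' + D ** C') (C ** B' + D ** D')"
  by (auto simp: vec_eq_iff block_mat_def matrix_matrix_mult_def UNIV_Plus_UNIV[symmetric]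
      sum.Plus simp del: UNIV_Plus_UNIV split: sum.split)

lemma mat_mult_left: "mat c ** (A :: complex^'n::finite^'n) = map_matrix ((*) c) A"
  by (simp add: vec_eq_iff matrix_matrix_mult_def mat_def if_distrib[of "\<lambda>x. x * _"] cong: if_cong)

lemma mat_mult_right: "(A :: complex^'n::finite^'n) ** mat c = map_matrix ((*) c) A"
  by (simp add: vec_eq_iff matrix_matrix_mult_def mat_def if_distrib[of "\<lambda>x. _ * x"] mult.commute cong: if_cong)

lemma matrix_inv_cayley:
  "matrix_inv (cayley :: complex^('n::finite + 'n)^('n + 'n)) = block_mat (mat (1/2)) (mat (\<i>/2)) (mat (1/2)) (mat (- \<i>/2))" (is "_ = ?X")
proof -
  have 1: "cayley ** ?X = (mat 1 :: complex^('n::finite + 'n)^('n + 'n))"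
    unfolding cayley_def block_mat_mult mat_mult_left
    by (auto simp: vec_eq_iff block_mat_def mat_def split: sum.split)
  have 2: "?X ** cayley = (mat 1 :: complex^('n::finite + 'n)^('n + 'n))"
    unfolding cayley_def block_mat_mult mat_mult_left
    by (auto simp: vec_eq_iff block_mat_def mat_def split: sum.split)
  have "invertible (cayley :: complex^('n::finite + 'n)^('n + 'n))"
    using 1 2 by (auto simp: invertible_def)
  hence 3: "matrix_inv cayley ** cayley = (mat 1 :: complex^('n::finite + 'n)^('n + 'n))"
    unfolding invertible_def matrix_inv_def by (rule someI2_ex) auto
  have "matrix_inv cayley = matrix_inv cayley ** (cayley ** ?X)"
    by (simp only: 1 matrix_mul_rid)
  also have "\<dots> = (matrix_inv cayley ** cayley) ** ?X"
    by (simp only: matrix_mul_assoc)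
  also have "\<dots> = ?X"
    by (simp only: 3 matrix_mul_lid)
  finally show ?thesis .
qed

lemma arg_cong4: "a = a' \<Longrightarrow> b = b' \<Longrightarrow> c = c' \<Longrightarrow> d = d' \<Longrightarrow> f a b c d = f a' b' c' d'"
  by simp

lemma Usp_parametrization:
  fixes U :: "complex^('n::finite + 'n)^('n + 'n)"
  assumes "U \<in> Usp"
  defines "s \<equiv> map_matrix (\<lambda>z. z / complex_of_real (sqrt 2))"
    and "J \<equiv> map_matrix ((*) \<i>)" and "f \<equiv> f_of U" and "h \<equiv> h_of U"
  shows "U = block_mat (s (f + J h)) (s (map_matrix cnj f + J (map_matrix cnj h)))
                       (s (f - J h)) (s (map_matrix cnj f - J (map_matrix cnj h)))"
proof -
  obtain A B C D :: "real^'n^'n"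
    where U: "U = matrix_inv cayley ** map_matrix complex_of_real (block_mat A B C D) ** cayley"
    using assms(1) by (auto simp: Usp_def real_symplectic_def)
  let ?c = "map_matrix complex_of_real"
  have S: "?c (block_mat A B C D) = block_mat (?c A) (?c B) (?c C) (?c D)"
    by (auto simp: vec_eq_iff block_mat_def split: sum.split)
  have "cayley ** matrix_inv cayley = (mat 1 :: complex^('n + 'n)^('n + 'n))"
    unfolding matrix_inv_cayley unfolding cayley_def block_mat_mult mat_mult_left
    by (auto simp: vec_eq_iff block_mat_def mat_def split: sum.split)
  note inv = this
  have "symplectic_of U =
      (cayley ** matrix_inv cayley) ** ?c (block_mat A B C D) ** (cayley ** matrix_inv cayley)"
    unfolding symplectic_of_def U by (simp only: matrix_mul_assoc)
  hence SU: "symplectic_of U = block_mat (?c A) (?c B) (?c C) (?c D)"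
    by (simp only: inv matrix_mul_lid matrix_mul_rid S)
  have fh: "f = (\<chi> i j. (of_real (A $ i $ j) - \<i> * of_real (B $ i $ j)) / of_real (sqrt 2))"
      "h = (\<chi> i j. (of_real (C $ i $ j) - \<i> * of_real (D $ i $ j)) / of_real (sqrt 2))"
    unfolding f_def h_def f_of_def h_of_def SU
    by (simp_all add: block11_def block12_def block21_def block22_def block_mat_def)
  have q: "(x / complex_of_real (sqrt 2) + \<i> * (y / complex_of_real (sqrt 2))) / complex_of_real (sqrt 2)
             = (x + \<i> * y) / 2"
    and q': "(x / complex_of_real (sqrt 2) - \<i> * (y / complex_of_real (sqrt 2))) / complex_of_real (sqrt 2)
             = (x - \<i> * y) / 2" for x y
    by (simp_all flip: of_real_mult add_divide_distrib diff_divide_distrib)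
  have "s (f + J h) = (\<chi> i j. ((A $ i $ j - \<i> * B $ i $ j) + \<i> * (C $ i $ j - \<i> * D $ i $ j)) / 2)"
    and "s (map_matrix cnj f + J (map_matrix cnj h)) =
           (\<chi> i j. ((A $ i $ j + \<i> * B $ i $ j) + \<i> * (C $ i $ j + \<i> * D $ i $ j)) / 2)"
    and "s (f - J h) = (\<chi> i j. ((A $ i $ j - \<i> * B $ i $ j) - \<i> * (C $ i $ j - \<i> * D $ i $ j)) / 2)"
    and "s (map_matrix cnj f - J (map_matrix cnj h)) =
           (\<chi> i j. ((A $ i $ j + \<i> * B $ i $ j) - \<i> * (C $ i $ j + \<i> * D $ i $ j)) / 2)"
    unfolding fh s_def J_def
    by (simp_all add: vec_eq_iff q q' del: divide_divide_eq_left times_divide_eq_right)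
  note eqs = this
  show ?thesis
    unfolding U S matrix_inv_cayley eqs
    unfolding cayley_def block_mat_mult mat_mult_left mat_mult_right
    by (intro arg_cong4[where f = block_mat]) (simp_all add: vec_eq_iff field_simps)
qed


section \<open>Embedded coset manifolds and coset representatives\<close>

text \<open>
  The differential at the unit element of a matrix-valued map, on point derivations: they act on
  the real and imaginary parts of the entries.
\<close>

definition differential ::
  "('g \<Rightarrow> complex^'n^'m) \<Rightarrow> (('g \<Rightarrow> real) \<Rightarrow> real) \<Rightarrow> complex^'n^'m" where
  "differential \<rho> v = (\<chi> i j. Complex (v (\<lambda>a. Re (\<rho> a $ i $ j))) (v (\<lambda>a. Im (\<rho> a $ i $ j))))"

text \<open>
  Smoothness of \<open>\<rho>\<close> as a map into the closed (embedded) subgroup \<open>Usp(n,n)\<close> is smoothness as a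
  map into the matrices.
\<close>

definition coset_embedding ::
  "('g, 'b) monoid_scheme \<Rightarrow> 'g topology \<Rightarrow> ('g, 'e::real_inner) atlas \<Rightarrow> 'g set \<Rightarrow>
   (('g \<Rightarrow> real) \<Rightarrow> real) set \<Rightarrow> ('g \<Rightarrow> complex^('n::finite + 'n)^('n + 'n)) \<Rightarrow> bool" where
  "coset_embedding G T \<A> H \<kk> \<rho> \<longleftrightarrow>
     lie_group G T \<A> \<and> subgroup H G \<and> closedin T H \<and>
     symmetric_decomposition G T \<A> H \<kk> \<and>
     \<rho> \<in> hom G Usp_group \<and> smooth_to_vec T \<A> (carrier G) \<rho> \<and>
     (\<forall>v\<in>lie_subalgebra G T \<A> H. \<exists>w. differential \<rho> v = block_mat w 0 0 (map_matrix cnj w)) \<and>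
     (\<forall>v\<in>\<kk>. \<exists>p. differential \<rho> v = block_mat 0 (map_matrix cnj p) p 0)"

text \<open>
  \<open>\<phi>\<close> is a chart of \<open>G/H\<close> with domain \<open>V\<close> and \<open>L\<close> is a smooth section of \<open>G \<rightarrow> G/H\<close> over \<open>V\<close>,
  written as a function of the coordinates, i.e.\ on the open set \<open>\<phi> ` V\<close>. The manifold
  structure of \<open>G/H\<close> enters through the projection \<open>a \<mapsto> a H\<close>: a set of cosets is open, and a
  map on it smooth, iff the preimage in \<open>G\<close> is open and the pullback smooth. Smoothness of
  \<open>\<phi>\<inverse>\<close> follows, as it is \<open>L\<close> followed by the projection.
\<close>

definition coset_representative ::
  "('g, 'b) monoid_scheme \<Rightarrow> 'g topology \<Rightarrow> ('g, 'e::real_inner) atlas \<Rightarrow> 'g set \<Rightarrow>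
   'g set set \<Rightarrow> ('g set \<Rightarrow> 'd::real_inner) \<Rightarrow> ('d \<Rightarrow> 'g) \<Rightarrow> bool" where
  "coset_representative G T \<A> H V \<phi> L \<longleftrightarrow>
     euclidean_model TYPE('d) \<and>
     V \<subseteq> lcosets\<^bsub>G\<^esub> H \<and> openin T (\<Union>V) \<and>
     inj_on \<phi> V \<and> open (\<phi> ` V) \<and> smooth_to_vec T \<A> (\<Union>V) (\<lambda>a. \<phi> (a <#\<^bsub>G\<^esub> H)) \<and>
     smooth_from_vec (\<phi> ` V) T \<A> L \<and> (\<forall>C\<in>V. L (\<phi> C) <#\<^bsub>G\<^esub> H = C)"


section \<open>Matrix-valued forms in coordinates\<close>

text \<open>A one-form takes a point and a tangent vector, a two-form a point and two tangent vectors.\<close>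

definition dform :: "('d::real_normed_vector \<Rightarrow> 'a::real_normed_vector) \<Rightarrow> 'd \<Rightarrow> 'd \<Rightarrow> 'a" where
  "dform F x v = frechet_derivative F (at x) v"

definition ext_deriv ::
  "('d::real_normed_vector \<Rightarrow> 'd \<Rightarrow> 'a::real_normed_vector) \<Rightarrow> 'd \<Rightarrow> 'd \<Rightarrow> 'd \<Rightarrow> 'a" where
  "ext_deriv \<alpha> x v w = dform (\<lambda>z. \<alpha> z w) x v - dform (\<lambda>z. \<alpha> z v) x w"

definition wedge ::
  "('d \<Rightarrow> 'd \<Rightarrow> complex^'n^'n) \<Rightarrow> ('d \<Rightarrow> 'd \<Rightarrow> complex^'n^'n) \<Rightarrow> 'd \<Rightarrow> 'd \<Rightarrow> 'd \<Rightarrow> complex^'n^'n" where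
  "wedge \<alpha> \<beta> x v w = \<alpha> x v ** \<beta> x w - \<alpha> x w ** \<beta> x v"

definition maurer_cartan ::
  "('d::real_normed_vector \<Rightarrow> complex^'k^'k) \<Rightarrow> 'd \<Rightarrow> 'd \<Rightarrow> complex^'k^'k" where
  "maurer_cartan U x v = matrix_inv (U x) ** dform U x v"

text \<open>\<open>\<nabla>V = dV - V \<omega>\<close>, for matrices and for row vectors.\<close>

definition cov_deriv_mat ::
  "('d::real_normed_vector \<Rightarrow> 'd \<Rightarrow> complex^'n^'n) \<Rightarrow> ('d \<Rightarrow> complex^'n^'m) \<Rightarrow> 'd \<Rightarrow> 'd \<Rightarrow> complex^'n^'m" where
  "cov_deriv_mat \<omega> F x v = dform F x v - F x ** \<omega> x v"

definition cov_deriv_row ::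
  "('d::real_normed_vector \<Rightarrow> 'd \<Rightarrow> complex^'n^'n) \<Rightarrow> ('d \<Rightarrow> complex^'n) \<Rightarrow> 'd \<Rightarrow> 'd \<Rightarrow> complex^'n" where
  "cov_deriv_row \<omega> F x v = dform F x v - F x v* \<omega> x v"

text \<open>The row vector of charges \<open>h\<^sub>\<Lambda> g\<^sup>\<Lambda> - f\<^sup>\<Lambda> e\<^sub>\<Lambda>\<close>.\<close>

definition charges ::
  "real^'n \<Rightarrow> real^'n \<Rightarrow> complex^'n^'n \<Rightarrow> complex^'n^'n \<Rightarrow> complex^'n" where
  "charges g e f h = (\<chi> c. \<Sum>\<Lambda>\<in>UNIV. h $ \<Lambda> $ c * complex_of_real (g $ \<Lambda>)
                                   - f $ \<Lambda> $ c * complex_of_real (e $ \<Lambda>))"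


section \<open>Column labels\<close>

text \<open>
  \<open>Inl (A, B)\<close> with \<open>A < B\<close> labels the independent antisymmetric pairs, \<open>Inr I\<close> the remaining
  columns. A labelling \<open>col\<close> is a bijection from these labels to the column index type.
\<close>

definition col_labels :: "nat \<Rightarrow> nat \<Rightarrow> (nat \<times> nat + nat) set" where
  "col_labels N m = Inl ` {(A, B). 1 \<le> A \<and> A < B \<and> B \<le> N} \<union> Inr ` {1..m}"

definition antisym_ext :: "(nat \<Rightarrow> nat \<Rightarrow> complex) \<Rightarrow> nat \<Rightarrow> nat \<Rightarrow> complex" where
  "antisym_ext F A B = (if A < B then F A B else if B < A then - F B A else 0)"

definition row_pair :: "(nat \<times> nat + nat \<Rightarrow> 'n) \<Rightarrow> complex^'n \<Rightarrow> nat \<Rightarrow> nat \<Rightarrow> complex" where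
  "row_pair col V A B = antisym_ext (\<lambda>A B. V $ col (Inl (A, B))) A B"

definition row_single :: "(nat \<times> nat + nat \<Rightarrow> 'n) \<Rightarrow> complex^'n \<Rightarrow> nat \<Rightarrow> complex" where
  "row_single col V I = V $ col (Inr I)"

definition mat_pair_pair ::
  "(nat \<times> nat + nat \<Rightarrow> 'n) \<Rightarrow> complex^'n^'n \<Rightarrow> nat \<Rightarrow> nat \<Rightarrow> nat \<Rightarrow> nat \<Rightarrow> complex" where
  "mat_pair_pair col P A B C D = antisym_ext (\<lambda>A B. row_pair col (P $ col (Inl (A, B))) C D) A B"

definition mat_pair_single ::
  "(nat \<times> nat + nat \<Rightarrow> 'n) \<Rightarrow> complex^'n^'n \<Rightarrow> nat \<Rightarrow> nat \<Rightarrow> nat \<Rightarrow> complex" where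
  "mat_pair_single col P A B J = antisym_ext (\<lambda>A B. row_single col (P $ col (Inl (A, B))) J) A B"

definition mat_single_pair ::
  "(nat \<times> nat + nat \<Rightarrow> 'n) \<Rightarrow> complex^'n^'n \<Rightarrow> nat \<Rightarrow> nat \<Rightarrow> nat \<Rightarrow> complex" where
  "mat_single_pair col P I C D = row_pair col (P $ col (Inr I)) C D"

definition mat_single_single ::
  "(nat \<times> nat + nat \<Rightarrow> 'n) \<Rightarrow> complex^'n^'n \<Rightarrow> nat \<Rightarrow> nat \<Rightarrow> complex" where
  "mat_single_single col P I J = row_single col (P $ col (Inr I)) J"

text \<open>Block-diagonal with respect to the splitting of the labels into \<open>AB\<close> and \<open>I\<close>.\<close>

definition label_block_diagonal ::
  "nat \<Rightarrow> nat \<Rightarrow> (nat \<times> nat + nat \<Rightarrow> 'n) \<Rightarrow> complex^'n^'n \<Rightarrow> bool" where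
  "label_block_diagonal N m col M \<longleftrightarrow>
     (\<forall>A\<in>{1..N}. \<forall>B\<in>{1..N}. \<forall>I\<in>{1..m}.
        mat_pair_single col M A B I = 0 \<and> mat_single_pair col M I A B = 0)"

end

theory Submission
  imports Defs
begin

text \<open>
  An element \<open>U\<close> of \<open>Usp(n,n)\<close> satisfies \<open>U\<^sub>2\<^sub>2 = cnj U\<^sub>1\<^sub>1\<close>, \<open>U\<^sub>1\<^sub>2 = cnj U\<^sub>2\<^sub>1\<close> and
  \<open>U\<^sup>-\<^sup>1 = - J U\<^sup>T J\<close>. The first two relations are real linear, hence inherited by \<open>dU\<close>, and they
  are preserved by products, which gives the block form of \<open>\<Gamma> = U\<^sup>-\<^sup>1 dU\<close>. Differentiating
  \<open>U\<^sup>-\<^sup>1 U = 1\<close> shows that \<open>\<Gamma>\<close> lies in the symplectic Lie algebra, so \<open>\<P>\<close> is symmetric (which is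
  what allows \<open>P\<^sub>A\<^sub>B\<^sub>C\<^sub>D\<close> instead of \<open>P\<^sub>C\<^sub>D\<^sub>A\<^sub>B\<close> in \<open>\<nabla>Z\<^sub>A\<^sub>B\<close>), and, with the symmetry of second
  derivatives, that \<open>d\<Gamma> + \<Gamma> \<and> \<Gamma> = 0\<close>. Since \<open>f = (U\<^sub>1\<^sub>1 + U\<^sub>2\<^sub>1) / \<surd>2\<close> and
  \<open>h = - \<i> (U\<^sub>1\<^sub>1 - U\<^sub>2\<^sub>1) / \<surd>2\<close>, the left column of \<open>dU = U \<Gamma>\<close> is \<open>\<nabla>f = cnj f \<P>\<close>,
  \<open>\<nabla>h = cnj h \<P>\<close>.
\<close>

subsection \<open>Functions of class \<open>C\<^sup>k\<close>\<close>

text \<open>Openness is what makes this work: \<open>frechet_derivative\<close> is taken in the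
  whole space, and agreement on \<open>S\<close> is agreement near each of its points, so the
  derivatives agree as well.\<close>

lemma Ck_on_cong:
  assumes "open S" "\<And>x. x \<in> S \<Longrightarrow> f x = g x" "Ck_on k S f"
  shows "Ck_on k S g"
  using assms(2,3)
proof (induction k arbitrary: f g)
  case 0
  then show ?case using continuous_on_cong[of S S f g] by auto
next
  case (Suc k)
  have der: "(g has_derivative frechet_derivative f (at x)) (at x)" if "x \<in> S" for x
    using Suc.prems that assms(1)
    by (auto simp: frechet_derivative_works intro: has_derivative_transform_within_open)
  have fr: "frechet_derivative f (at x) = frechet_derivative g (at x)" if "x \<in> S" for x
    using frechet_derivative_at[OF der[OF that]] .
  show ?case
    unfolding Ck_on.simps
  proof (intro conjI ballI allI)
    fix x assume "x \<in> S" then show "g differentiable at x" using der differentiable_def by blast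
  next
    fix v
    show "Ck_on k S (\<lambda>x. frechet_derivative g (at x) v)"
      by (rule Suc.IH[of "\<lambda>x. frechet_derivative f (at x) v"]) (use Suc.prems fr in auto)
  qed
qed

lemma Ck_on_SucD: "Ck_on (Suc k) S f \<Longrightarrow> Ck_on k S f"
proof (induction k arbitrary: f)
  case 0
  then show ?case
    by (auto intro!: continuous_at_imp_continuous_on differentiable_imp_continuous_within)
next
  case (Suc k)
  then show ?case by auto
qed

text \<open>Allows an explicit derivative \<open>f'\<close>, as produced by a differentiation rule,
  in place of the chosen \<open>frechet_derivative\<close> in the recursion.\<close>

lemma Ck_on_SucI:
  assumes "open S" "\<And>x. x \<in> S \<Longrightarrow> (f has_derivative f' x) (at x)"
    and "\<And>v. Ck_on k S (\<lambda>x. f' x v)"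
  shows "Ck_on (Suc k) S f"
  unfolding Ck_on.simps
proof (intro conjI ballI allI)
  fix x assume "x \<in> S" then show "f differentiable at x" using assms(2) differentiable_def by blast
next
  fix v
  show "Ck_on k S (\<lambda>x. frechet_derivative f (at x) v)"
    by (rule Ck_on_cong[OF assms(1) _ assms(3)[of v]]) (use assms(2) frechet_derivative_at in fastforce)
qed

lemma Ck_on_Suc_has_derivative:
  "Ck_on (Suc k) S f \<Longrightarrow> x \<in> S \<Longrightarrow> (f has_derivative frechet_derivative f (at x)) (at x)"
  by (simp add: frechet_derivative_works)

lemma Ck_on_const: "open S \<Longrightarrow> Ck_on k S (\<lambda>x. c)"
  by (induction k arbitrary: c) (auto simp: frechet_derivative_const)

lemma Ck_on_add:
  assumes "open S" "Ck_on k S f" "Ck_on k S g"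
  shows "Ck_on k S (\<lambda>x. f x + g x)"
  using assms(2,3)
proof (induction k arbitrary: f g)
  case 0
  then show ?case by (simp add: continuous_on_add)
next
  case (Suc k)
  show ?case
  proof (rule Ck_on_SucI[OF assms(1)])
    fix x assume "x \<in> S"
    then show "((\<lambda>x. f x + g x) has_derivative
        (\<lambda>v. frechet_derivative f (at x) v + frechet_derivative g (at x) v)) (at x)"
      using Suc.prems by (intro has_derivative_add Ck_on_Suc_has_derivative)
  qed (rule Suc.IH; use Suc.prems in simp)
qed

lemma Ck_on_sum:
  assumes "open S" "\<And>i. i \<in> I \<Longrightarrow> Ck_on k S (f i)"
  shows "Ck_on k S (\<lambda>x. \<Sum>i\<in>I. f i x)"
  using assms(2)
  by (induction I rule: infinite_finite_induct) (simp_all add: Ck_on_const Ck_on_add assms(1))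

text \<open>The product rule leaves one factor undifferentiated in each summand;
  \<open>Ck_on_SucD\<close> lowers its order so that the induction hypothesis applies.\<close>

lemma Ck_on_scaleR:
  fixes f :: "'a::real_normed_vector \<Rightarrow> real"
  assumes "open S" "Ck_on k S f" "Ck_on k S g"
  shows "Ck_on k S (\<lambda>x. f x *\<^sub>R g x)"
  using assms(2,3)
proof (induction k arbitrary: f g)
  case 0
  then show ?case by (simp add: continuous_on_scaleR)
next
  case (Suc k)
  note SucD = Suc.prems[THEN Ck_on_SucD]
  show ?case
  proof (rule Ck_on_SucI[OF assms(1)])
    fix x assume "x \<in> S"
    then show "((\<lambda>x. f x *\<^sub>R g x) has_derivative
        (\<lambda>v. f x *\<^sub>R frechet_derivative g (at x) v + frechet_derivative f (at x) v *\<^sub>R g x)) (at x)"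
      using Suc.prems by (intro has_derivative_scaleR Ck_on_Suc_has_derivative)
  next
    fix v
    show "Ck_on k S (\<lambda>x. f x *\<^sub>R frechet_derivative g (at x) v + frechet_derivative f (at x) v *\<^sub>R g x)"
      by (rule Ck_on_add[OF assms(1)]; rule Suc.IH) (use Suc.prems SucD in simp_all)
  qed
qed

lemma Ck_on_bounded_linear:
  assumes "open S" "bounded_linear l" "Ck_on k S f"
  shows "Ck_on k S (\<lambda>x. l (f x))"
  using assms(3)
proof (induction k arbitrary: f)
  case 0
  then show ?case using bounded_linear.continuous_on[OF assms(2)] by auto
next
  case (Suc k)
  show ?case
    by (rule Ck_on_SucI[OF assms(1)],
        rule bounded_linear.has_derivative[OF assms(2) Ck_on_Suc_has_derivative],
        rule Suc.prems, assumption)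
       (rule Suc.IH; use Suc.prems in auto)
qed

section \<open>Orthonormal expansions and the chain rule\<close>

lemma orthonormal_expansion:
  fixes B :: "'e::real_inner set"
  assumes "finite B" "\<forall>b\<in>B. \<forall>c\<in>B. inner b c = (if b = c then 1 else 0)" "span B = UNIV"
  shows "u = (\<Sum>b\<in>B. inner u b *\<^sub>R b)"
proof -
  obtain c where u: "u = (\<Sum>b\<in>B. c b *\<^sub>R b)"
    using assms(1,3) span_finite[of B] by auto
  have "inner u b = c b" if "b \<in> B" for b
  proof -
    have "inner u b = (\<Sum>a\<in>B. c a * inner a b)"
      unfolding u by (simp add: inner_sum_left)
    also have "\<dots> = (\<Sum>a\<in>B. if a = b then c a else 0)"
      using assms(2) that by (intro sum.cong) auto
    finally show ?thesis using assms(1) that by simp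
  qed
  then show ?thesis by (subst u) (simp cong: sum.cong)
qed

text \<open>In the chain rule the outer derivative is taken in a direction that moves with the
  point, whereas \<open>Ck_on\<close> controls fixed directions only. Expanding the moving direction
  in an orthonormal basis gives a finite sum of products, each covered by the induction
  hypothesis.\<close>

lemma Ck_on_compose:
  fixes f :: "'d::real_normed_vector \<Rightarrow> 'e::real_inner" and g :: "'e \<Rightarrow> 'b::real_normed_vector"
  assumes e: "euclidean_model TYPE('e)" and "open S" "open R" "f ` S \<subseteq> R"
    and "Ck_on k S f" "Ck_on k R g"
  shows "Ck_on k S (\<lambda>x. g (f x))"
  using assms(5,6)
proof (induction k arbitrary: g)
  case 0
  then show ?case using assms(4) continuous_on_compose2 by auto
next
  case (Suc k)
  obtain B :: "'e set" where B: "finite B" "\<forall>b\<in>B. \<forall>c\<in>B. inner b c = (if b = c then 1 else 0)"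
      "span B = UNIV"
    using e by (auto simp: euclidean_model_def)
  let ?f = "\<lambda>x. frechet_derivative f (at x)" and ?g = "\<lambda>y. frechet_derivative g (at y)"
  show ?case
  proof (rule Ck_on_SucI[OF assms(2)])
    fix x assume x: "x \<in> S"
    have f: "(f has_derivative ?f x) (at x)"
      using Suc.prems(1) x by (rule Ck_on_Suc_has_derivative)
    have g: "(g has_derivative ?g (f x)) (at (f x))"
      using Suc.prems(2) by (rule Ck_on_Suc_has_derivative) (use x assms(4) in auto)
    have "?g (f x) (?f x v) = (\<Sum>b\<in>B. inner (?f x v) b *\<^sub>R ?g (f x) b)" for v
    proof -
      interpret linear "?g (f x)" using g by (rule has_derivative_linear)
      have "?g (f x) (?f x v) = ?g (f x) (\<Sum>b\<in>B. inner (?f x v) b *\<^sub>R b)"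
        using orthonormal_expansion[OF B, of "?f x v"] by simp
      then show ?thesis by (simp add: sum scaleR)
    qed
    then show "((\<lambda>x. g (f x)) has_derivative (\<lambda>v. \<Sum>b\<in>B. inner (?f x v) b *\<^sub>R ?g (f x) b)) (at x)"
      using diff_chain_at[OF f g] by (simp add: o_def)
  next
    fix v
    show "Ck_on k S (\<lambda>x. \<Sum>b\<in>B. inner (?f x v) b *\<^sub>R ?g (f x) b)"
    proof (intro Ck_on_sum Ck_on_scaleR assms(2))
      fix b
      show "Ck_on k S (\<lambda>x. inner (?f x v) b)"
        by (rule Ck_on_bounded_linear[OF assms(2) bounded_linear_inner_left]) (use Suc.prems in auto)
      show "Ck_on k S (\<lambda>x. ?g (f x) b)"
        by (rule Suc.IH[of "\<lambda>y. ?g y b"]) (use Suc.prems Ck_on_SucD in auto)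
    qed
  qed
qed

lemma frechet_derivative_bounded_linear:
  assumes "bounded_linear l" "f differentiable (at x)"
  shows "frechet_derivative (\<lambda>y. l (f y)) (at x) v = l (frechet_derivative f (at x) v)"
  using frechet_derivative_at[OF bounded_linear.has_derivative[OF assms(1)
      assms(2)[unfolded frechet_derivative_works]]]
  by (rule fun_cong[symmetric])

subsection \<open>Symmetry of second derivatives\<close>

lemma directional_derivative:
  assumes "(F has_derivative F') (at (a + s *\<^sub>R v))"
  shows "((\<lambda>s. F (a + s *\<^sub>R v)) has_derivative (\<lambda>t. t *\<^sub>R F' v)) (at s)"
proof -
  have "((\<lambda>s. a + s *\<^sub>R v) has_derivative (\<lambda>t. t *\<^sub>R v)) (at s)"
    by (auto intro!: derivative_eq_intros)
  from diff_chain_at[OF this assms] show ?thesis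
    using has_derivative_linear[OF assms] by (simp add: o_def linear_scale)
qed

lemma directional_real_derivative:
  fixes F :: "'d::real_normed_vector \<Rightarrow> real"
  assumes "Ck_on (Suc k) S F" "a + s *\<^sub>R v \<in> S"
  shows "((\<lambda>s. F (a + s *\<^sub>R v)) has_real_derivative frechet_derivative F (at (a + s *\<^sub>R v)) v) (at s)"
  using directional_derivative[OF Ck_on_Suc_has_derivative[OF assms]]
  by (simp add: has_field_derivative_def mult_commute_abs)

text \<open>
  The left-hand side of the equation is symmetric in \<open>v\<close> and \<open>w\<close>, so each mixed derivative takes,
  arbitrarily close to \<open>x\<close>, a value of the other one.
\<close>

lemma second_difference_mean_value:
  fixes F :: "'d::real_normed_vector \<Rightarrow> real"
  assumes F: "Ck_on 2 S F" and h: "h > 0"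
    and S: "\<And>s t. 0 \<le> s \<Longrightarrow> s \<le> h \<Longrightarrow> 0 \<le> t \<Longrightarrow> t \<le> h \<Longrightarrow> x + s *\<^sub>R v + t *\<^sub>R w \<in> S"
  shows "\<exists>s t. 0 \<le> s \<and> s \<le> h \<and> 0 \<le> t \<and> t \<le> h \<and>
     F (x + h *\<^sub>R v + h *\<^sub>R w) - F (x + h *\<^sub>R v) - F (x + h *\<^sub>R w) + F x =
     h * h * frechet_derivative (\<lambda>z. frechet_derivative F (at z) v) (at (x + s *\<^sub>R v + t *\<^sub>R w)) w"
proof -
  have F1: "Ck_on (Suc 1) S F" using F by (simp add: numeral_2_eq_2)
  have F2: "Ck_on (Suc 0) S (\<lambda>z. frechet_derivative F (at z) v)" using F1 by simp
  \<comment> \<open>The second difference over the square is \<open>?d h - ?d 0\<close>; the mean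
    value theorem in \<open>s\<close> and then in \<open>t\<close> turns it into a single mixed
    derivative.\<close>
  let ?d = "\<lambda>s. F (x + h *\<^sub>R w + s *\<^sub>R v) - F (x + s *\<^sub>R v)"
  have "(?d has_real_derivative frechet_derivative F (at (x + h *\<^sub>R w + s *\<^sub>R v)) v
        - frechet_derivative F (at (x + s *\<^sub>R v)) v) (at s)" if "0 \<le> s" "s \<le> h" for s
    using S[of s h] S[of s 0] that h
    by (intro DERIV_diff directional_real_derivative[OF F1]) (auto simp: add_ac)
  from MVT2[OF h this]
  obtain s where s: "0 < s" "s < h" "?d h - ?d 0 = h * (frechet_derivative F (at (x + h *\<^sub>R w + s *\<^sub>R v)) v
        - frechet_derivative F (at (x + s *\<^sub>R v)) v)" by auto
  have "((\<lambda>t. frechet_derivative F (at (x + s *\<^sub>R v + t *\<^sub>R w)) v) has_real_derivative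
      frechet_derivative (\<lambda>z. frechet_derivative F (at z) v) (at (x + s *\<^sub>R v + t *\<^sub>R w)) w) (at t)"
    if "0 \<le> t" "t \<le> h" for t
    by (intro directional_real_derivative[OF F2]) (use S that s in auto)
  from MVT2[OF h this]
  obtain t where t: "0 < t" "t < h"
     "frechet_derivative F (at (x + s *\<^sub>R v + h *\<^sub>R w)) v - frechet_derivative F (at (x + s *\<^sub>R v)) v
      = h * frechet_derivative (\<lambda>z. frechet_derivative F (at z) v) (at (x + s *\<^sub>R v + t *\<^sub>R w)) w"
    by auto
  show ?thesis
    using s t by (intro exI[of _ s] exI[of _ t]) (auto simp: algebra_simps)
qed

text \<open>On squares shrinking to \<open>x\<close>, the two mixed derivatives share a value at
  points \<open>a n\<close> and \<open>b n\<close> that both tend to \<open>x\<close>; continuity of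
  the mixed derivatives then equates their values at \<open>x\<close>.\<close>

lemma second_derivative_symmetric_real:
  fixes F :: "'d::real_normed_vector \<Rightarrow> real"
  assumes S: "open S" and F: "Ck_on 2 S F" and x: "x \<in> S"
  shows "frechet_derivative (\<lambda>z. frechet_derivative F (at z) v) (at x) w =
         frechet_derivative (\<lambda>z. frechet_derivative F (at z) w) (at x) v"
proof -
  let ?D = "\<lambda>v w x. frechet_derivative (\<lambda>z. frechet_derivative F (at z) v) (at x) w"
  obtain r where r: "r > 0" "ball x r \<subseteq> S" using S x openE by blast
  \<comment> \<open>The summand 1 keeps \<open>c\<close> positive when \<open>v\<close> and
    \<open>w\<close> both vanish; \<open>n + 2\<close> makes \<open>h n * c\<close> strictly smaller
    than \<open>r\<close> already for \<open>n = 0\<close>.\<close>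
  define c where "c = norm v + norm w + 1"
  have c: "c > 0" by (simp add: c_def add_nonneg_pos)
  define h where "h n = r / c / real (n + 2)" for n
  have h: "h n > 0" for n
    using r c by (simp add: h_def)
  have h_c: "h n * c = r * inverse (real (n + 2))" for n
    using c by (simp add: h_def divide_inverse)
  have hc: "h n * c < r" for n
    unfolding h_c using r by (simp add: field_simps add_pos_nonneg)
  have bound: "norm (s *\<^sub>R v + t *\<^sub>R w) \<le> h n * c"
    if "0 \<le> s" "s \<le> h n" "0 \<le> t" "t \<le> h n" for s t n
  proof -
    have "norm (s *\<^sub>R v + t *\<^sub>R w) \<le> s * norm v + t * norm w"
      using norm_triangle_ineq[of "s *\<^sub>R v" "t *\<^sub>R w"] that by simp
    also have "\<dots> \<le> h n * norm v + h n * norm w"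
      using that by (intro add_mono mult_right_mono) auto
    also have "\<dots> \<le> h n * c" using h[of n] by (simp add: c_def algebra_simps)
    finally show ?thesis .
  qed
  have near: "x + s *\<^sub>R v + t *\<^sub>R w \<in> S" if "0 \<le> s" "s \<le> h n" "0 \<le> t" "t \<le> h n" for s t n
  proof -
    have "dist x (x + s *\<^sub>R v + t *\<^sub>R w) < r"
      using bound[OF that] hc[of n] by (simp add: dist_norm norm_minus_commute algebra_simps)
    then show ?thesis using r by auto
  qed
  have near': "x + s *\<^sub>R w + t *\<^sub>R v \<in> S" if "0 \<le> s" "s \<le> h n" "0 \<le> t" "t \<le> h n" for s t n
    using near[of t n s] that by (simp add: add_ac)
  have "\<exists>a b. dist a x \<le> h n * c \<and> dist b x \<le> h n * c \<and> a \<in> S \<and> b \<in> S \<and> ?D v w a = ?D w v b" for n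
  proof -
    obtain s t where st: "0 \<le> s" "s \<le> h n" "0 \<le> t" "t \<le> h n"
      and 1: "F (x + h n *\<^sub>R v + h n *\<^sub>R w) - F (x + h n *\<^sub>R v) - F (x + h n *\<^sub>R w) + F x =
        h n * h n * ?D v w (x + s *\<^sub>R v + t *\<^sub>R w)"
      using second_difference_mean_value[OF F h[of n], of x v w] near[of _ n] by blast
    obtain s' t' where st': "0 \<le> s'" "s' \<le> h n" "0 \<le> t'" "t' \<le> h n"
      and 2: "F (x + h n *\<^sub>R w + h n *\<^sub>R v) - F (x + h n *\<^sub>R w) - F (x + h n *\<^sub>R v) + F x =
        h n * h n * ?D w v (x + s' *\<^sub>R w + t' *\<^sub>R v)"
      using second_difference_mean_value[OF F h[of n], of x w v] near'[of _ n] by blast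
    have "h n * h n * ?D v w (x + s *\<^sub>R v + t *\<^sub>R w) = h n * h n * ?D w v (x + s' *\<^sub>R w + t' *\<^sub>R v)"
      using 1 2[unfolded add.assoc[of x] add.commute[of "h n *\<^sub>R w"]] unfolding add.assoc[of x] by linarith
    then have "?D v w (x + s *\<^sub>R v + t *\<^sub>R w) = ?D w v (x + s' *\<^sub>R w + t' *\<^sub>R v)"
      using h[of n] by simp
    moreover have "dist (x + s *\<^sub>R v + t *\<^sub>R w) x \<le> h n * c"
      using bound[OF st] by (simp add: dist_norm algebra_simps)
    moreover have "dist (x + s' *\<^sub>R w + t' *\<^sub>R v) x \<le> h n * c"
      using bound[of t' n s'] st' by (simp add: dist_norm algebra_simps)
    ultimately show ?thesis using near[OF st] near'[OF st'] by blast
  qed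
  then obtain a b where ab: "\<And>n. dist (a n) x \<le> h n * c" "\<And>n. dist (b n) x \<le> h n * c"
      "\<And>n. a n \<in> S" "\<And>n. b n \<in> S" "\<And>n. ?D v w (a n) = ?D w v (b n)" by metis
  have "(\<lambda>n. r * inverse (real (n + 2))) \<longlonglongrightarrow> r * 0"
    by (intro tendsto_mult tendsto_const LIMSEQ_ignore_initial_segment[OF lim_inverse_n])
  then have h0: "(\<lambda>n. h n * c) \<longlonglongrightarrow> 0" by (simp add: h_c)
  have lim: "a \<longlonglongrightarrow> x" "b \<longlonglongrightarrow> x"
    by (rule metric_tendsto_imp_tendsto[OF h0], use ab(1,2) in \<open>simp add: order_trans[OF _ abs_ge_self]\<close>)+
  have cont: "continuous_on S (?D v w)" "continuous_on S (?D w v)"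
    using F by (simp_all add: numeral_2_eq_2)
  have "(\<lambda>n. ?D v w (a n)) \<longlonglongrightarrow> ?D v w x" "(\<lambda>n. ?D w v (b n)) \<longlonglongrightarrow> ?D w v x"
    by (rule continuous_on_tendsto_compose[OF cont(1) lim(1) x] continuous_on_tendsto_compose[OF cont(2) lim(2) x],
        simp add: ab(3,4))+
  then show ?thesis using ab(5) LIMSEQ_unique by simp
qed

text \<open>Reduces to the real case one component at a time, since taking the inner product with a
  basis vector commutes with differentiation.\<close>

lemma second_derivative_symmetric:
  fixes F :: "'d::real_normed_vector \<Rightarrow> 'b::euclidean_space"
  assumes S: "open S" and F: "Ck_on 2 S F" and x: "x \<in> S"
  shows "frechet_derivative (\<lambda>z. frechet_derivative F (at z) v) (at x) w =
         frechet_derivative (\<lambda>z. frechet_derivative F (at z) w) (at x) v"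
proof (rule euclidean_eqI)
  fix b :: 'b
  let ?l = "\<lambda>y. inner y b"
  note l = bounded_linear_inner_left[of b]
  have F': "Ck_on (Suc (Suc 0)) S F" using F by (simp add: numeral_2_eq_2)
  have 1: "frechet_derivative (\<lambda>y. ?l (F y)) (at z) v = ?l (frechet_derivative F (at z) v)"
    if "z \<in> S" for z v
    using F' that by (intro frechet_derivative_bounded_linear[OF l]) simp
  have 2: "frechet_derivative (\<lambda>z. frechet_derivative (\<lambda>y. ?l (F y)) (at z) v) (at x) w
      = ?l (frechet_derivative (\<lambda>z. frechet_derivative F (at z) v) (at x) w)" for v w
  proof -
    have d: "(\<lambda>z. frechet_derivative F (at z) v) differentiable at x" using F' x by simp
    have "(\<lambda>z. ?l (frechet_derivative F (at z) v)) differentiable at x"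
      using differentiable_compose[OF bounded_linear_imp_differentiable[OF l] d] by simp
    from frechet_derivative_transform_within_open[OF this S x]
    have "frechet_derivative (\<lambda>z. ?l (frechet_derivative F (at z) v)) (at x)
        = frechet_derivative (\<lambda>z. frechet_derivative (\<lambda>y. ?l (F y)) (at z) v) (at x)"
      using 1 by metis
    then show ?thesis using frechet_derivative_bounded_linear[OF l d] by metis
  qed
  have "Ck_on 2 S (\<lambda>y. ?l (F y))" by (rule Ck_on_bounded_linear[OF S l F])
  from second_derivative_symmetric_real[OF S this x, of v w]
  show "?l (frechet_derivative (\<lambda>z. frechet_derivative F (at z) v) (at x) w) =
      ?l (frechet_derivative (\<lambda>z. frechet_derivative F (at z) w) (at x) v)"
    by (simp only: 2)
qed

subsection \<open>Block matrices and \<open>Usp(n,n)\<close>\<close>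

lemma block_mat_blocks: "block_mat (block11 M) (block12 M) (block21 M) (block22 M) = M"
  by (auto simp: vec_eq_iff block_mat_def block11_def block12_def block21_def block22_def split: sum.split)

lemma blocks_block_mat [simp]:
  "block11 (block_mat A B C D) = A" "block12 (block_mat A B C D) = B"
  "block21 (block_mat A B C D) = C" "block22 (block_mat A B C D) = D"
  by (simp_all add: vec_eq_iff block_mat_def block11_def block12_def block21_def block22_def)

lemma mat_block_mat: "(mat c :: complex^('n::finite + 'n)^('n + 'n)) = block_mat (mat c) 0 0 (mat c)"
  by (auto simp: vec_eq_iff block_mat_def mat_def split: sum.split)

lemma blocks_mult:
  fixes M M' :: "complex^('n::finite + 'n)^('n + 'n)"
  shows "block11 (M ** M') = block11 M ** block11 M' + block12 M ** block21 M'"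
    and "block12 (M ** M') = block11 M ** block12 M' + block12 M ** block22 M'"
    and "block21 (M ** M') = block21 M ** block11 M' + block22 M ** block21 M'"
    and "block22 (M ** M') = block21 M ** block12 M' + block22 M ** block22 M'"
proof -
  have "M ** M' = block_mat (block11 M) (block12 M) (block21 M) (block22 M) **
      block_mat (block11 M') (block12 M') (block21 M') (block22 M')"
    by (simp only: block_mat_blocks)
  note eq = this[unfolded block_mat_mult]
  show "block11 (M ** M') = block11 M ** block11 M' + block12 M ** block21 M'"
    and "block12 (M ** M') = block11 M ** block12 M' + block12 M ** block22 M'"
    and "block21 (M ** M') = block21 M ** block11 M' + block22 M ** block21 M'"
    and "block22 (M ** M') = block21 M ** block12 M' + block22 M ** block22 M'"
    by (simp_all add: eq)
qed

lemma map_matrix_cnj_mult: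
  "map_matrix cnj (A ** B) = map_matrix cnj A ** map_matrix cnj (B :: complex^'p^'n::finite)"
  by (simp add: vec_eq_iff matrix_matrix_mult_def)

lemma map_matrix_cnj_add: "map_matrix cnj (A + B) = map_matrix cnj A + map_matrix cnj B"
  by (simp add: vec_eq_iff)

lemma map_matrix_cnj_cnj [simp]: "map_matrix cnj (map_matrix cnj A) = A"
  by (simp add: vec_eq_iff)

lemma transpose_add: "transpose (A + B) = transpose A + transpose (B :: 'a::plus^'n^'m)"
  by (simp add: vec_eq_iff transpose_def)

lemma transpose_uminus: "transpose (- A) = - transpose (A :: 'a::uminus^'n^'m)"
  by (simp add: vec_eq_iff transpose_def)

lemma mult_uminus_left: "(- A) ** B = - (A ** (B :: complex^'p^'n::finite))"
  by (simp add: vec_eq_iff matrix_matrix_mult_def sum_negf)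

lemma mult_uminus_right: "A ** (- B) = - (A ** (B :: complex^'p^'n::finite))"
  by (simp add: vec_eq_iff matrix_matrix_mult_def sum_negf)

text \<open>Supplies the product rule for matrix-valued functions, and the distributive and real
  scaling laws of the matrix product.\<close>

lemma bounded_bilinear_matrix_mult:
  "bounded_bilinear ((**) :: complex^'n::finite^'m::finite \<Rightarrow> complex^'p::finite^'n \<Rightarrow> complex^'p^'m)"
  unfolding bilinear_conv_bounded_bilinear[symmetric] bilinear_def
  by (auto intro!: linearI simp: vec_eq_iff matrix_matrix_mult_def sum.distrib algebra_simps
      scaleR_sum_right)

text \<open>
  The anti-automorphism \<open>M \<mapsto> - J M\<^sup>T J\<close> for \<open>J = block_mat 0 1 (-1) 0\<close>: it inverts the elements
  of \<open>Sp(2n)\<close> and negates those of its Lie algebra.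
\<close>

definition symplectic_adjoint :: "complex^('n::finite + 'n)^('n + 'n) \<Rightarrow> complex^('n + 'n)^('n + 'n)" where
  "symplectic_adjoint M = block_mat (transpose (block22 M)) (- transpose (block12 M))
     (- transpose (block21 M)) (transpose (block11 M))"

lemma symplectic_adjoint_mult:
  "symplectic_adjoint (M ** M') = symplectic_adjoint M' ** symplectic_adjoint M"
  by (simp add: symplectic_adjoint_def block_mat_mult blocks_mult transpose_add matrix_transpose_mul
      mult_uminus_left mult_uminus_right add.commute)

lemma symplectic_adjoint_adjoint [simp]: "symplectic_adjoint (symplectic_adjoint M) = M"
  by (simp add: symplectic_adjoint_def transpose_uminus block_mat_blocks)

lemma bounded_linear_symplectic_adjoint: "bounded_linear symplectic_adjoint"
  unfolding linear_conv_bounded_linear[symmetric]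
  by (auto intro!: linearI simp: symplectic_adjoint_def vec_eq_iff transpose_def block_mat_def
      block11_def block12_def block21_def block22_def split: sum.split)

text \<open>These are the conjugates by \<open>cayley\<close> of real matrices, hence a real
  algebra: the reality half of the definition of \<open>Usp\<close>, without the symplectic
  relations.\<close>

definition conj_symmetric :: "complex^('n::finite + 'n)^('n + 'n) \<Rightarrow> bool" where
  "conj_symmetric M \<longleftrightarrow>
     block12 M = map_matrix cnj (block21 M) \<and> block22 M = map_matrix cnj (block11 M)"

lemma conj_symmetric_mult:
  "conj_symmetric M \<Longrightarrow> conj_symmetric M' \<Longrightarrow> conj_symmetric (M ** M')"
  by (simp add: conj_symmetric_def blocks_mult map_matrix_cnj_mult map_matrix_cnj_add add.commute)

lemma conj_symmetric_symplectic_adjoint: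
  "conj_symmetric M \<Longrightarrow> conj_symmetric (symplectic_adjoint M)"
  by (auto simp: conj_symmetric_def symplectic_adjoint_def vec_eq_iff transpose_def)

lemma conj_symmetric_Usp:
  assumes "U \<in> Usp" shows "conj_symmetric U"
  by (subst Usp_parametrization[OF assms], subst conj_symmetric_def) (simp add: vec_eq_iff)

text \<open>For a real symplectic matrix the claim is the list of its block relations. The matrix
  \<open>cayley\<close> is symplectic only up to a scalar: it contributes 2i and its inverse -i/2,
  and these central factors multiply to 1.\<close>

lemma symplectic_adjoint_Usp:
  fixes U :: "complex^('n::finite + 'n)^('n + 'n)"
  assumes "U \<in> Usp"
  shows "symplectic_adjoint U ** U = mat 1"
proof -
  obtain A B C D :: "real^'n^'n"
    where U: "U = matrix_inv cayley ** map_matrix complex_of_real (block_mat A B C D) ** cayley"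
      and rel: "transpose A ** C - transpose C ** A = 0" "transpose B ** D - transpose D ** B = 0"
        "transpose A ** D - transpose C ** B = mat 1"
    using assms by (auto simp: Usp_def real_symplectic_def)
  let ?c = "map_matrix complex_of_real :: real^'n^'n \<Rightarrow> _"
  let ?S = "map_matrix complex_of_real (block_mat A B C D)"
  have S: "?S = block_mat (?c A) (?c B) (?c C) (?c D)"
    by (auto simp: vec_eq_iff block_mat_def split: sum.split)
  have of_real: "transpose (?c X) ** ?c Y = ?c (transpose X ** Y)" for X Y
    by (simp add: vec_eq_iff matrix_matrix_mult_def transpose_def)
  have c_diff: "?c X - ?c Y = ?c (X - Y)" for X Y by (simp add: vec_eq_iff)
  \<comment> \<open>The upper left block of the product is the transpose of the third symplectic
    relation.\<close>
  have rel': "transpose D ** A - transpose B ** C = mat 1"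
    using arg_cong[OF rel(3), of transpose]
    by (simp add: matrix_transpose_mul transpose_def vec_eq_iff mat_def matrix_matrix_mult_def
        mult.commute)
  have S1: "symplectic_adjoint ?S ** ?S = mat 1"
  proof -
    have "symplectic_adjoint ?S ** ?S = block_mat (?c (transpose D ** A - transpose B ** C))
        (?c (- (transpose B ** D - transpose D ** B))) (?c (transpose A ** C - transpose C ** A))
        (?c (transpose A ** D - transpose C ** B))"
      unfolding S symplectic_adjoint_def blocks_block_mat block_mat_mult
      by (intro arg_cong4[where f = block_mat])
         (simp_all add: mult_uminus_left of_real c_diff[symmetric])
    then show ?thesis
      unfolding rel rel' by (simp add: mat_def vec_eq_iff block_mat_def split: sum.split)
  qed
  have 1: "symplectic_adjoint (matrix_inv cayley) ** matrix_inv cayley =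
      (mat (- \<i>/2) :: complex^('n + 'n)^('n + 'n))"
    unfolding matrix_inv_cayley symplectic_adjoint_def blocks_block_mat block_mat_mult transpose_mat mat_block_mat
    by (intro arg_cong4[where f = block_mat]) (simp_all add: mat_mult_left mult_uminus_left, simp_all add: vec_eq_iff mat_def)
  have 2: "symplectic_adjoint cayley ** cayley = (mat (2 * \<i>) :: complex^('n + 'n)^('n + 'n))"
    unfolding cayley_def symplectic_adjoint_def blocks_block_mat block_mat_mult transpose_mat mat_block_mat
    by (intro arg_cong4[where f = block_mat]) (simp_all add: mat_mult_left mult_uminus_left, simp_all add: vec_eq_iff mat_def)
  have mat_comm: "mat c ** M = M ** mat c" for c and M :: "complex^('n + 'n)^('n + 'n)"
    by (simp only: mat_mult_left mat_mult_right)
  \<comment> \<open>The adjoint reverses products, so the factors cancel from the inside outwards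
    once each scalar has been moved past its neighbour.\<close>
  have "symplectic_adjoint U ** U = symplectic_adjoint cayley ** (symplectic_adjoint ?S **
      (symplectic_adjoint (matrix_inv cayley) ** matrix_inv cayley ** ?S)) ** cayley"
    unfolding U symplectic_adjoint_mult by (simp only: matrix_mul_assoc)
  also have "\<dots> = symplectic_adjoint cayley ** (symplectic_adjoint ?S ** ?S ** mat (- \<i>/2)) ** cayley"
    by (simp only: 1 mat_comm[of _ ?S] matrix_mul_assoc)
  also have "\<dots> = mat (- \<i>/2) ** (symplectic_adjoint cayley ** cayley)"
    by (simp only: S1 matrix_mul_lid mat_comm[of _ "symplectic_adjoint cayley"] matrix_mul_assoc)
  also have "\<dots> = mat 1"
    unfolding 2 mat_mult_left by (simp add: vec_eq_iff mat_def)
  finally show ?thesis .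
qed

text \<open>For square matrices a left inverse is two-sided, and uniqueness of inverses identifies
  the matrix chosen by \<open>matrix_inv\<close>.\<close>

lemma matrix_inv_eqI:
  fixes A B :: "complex^'n::finite^'n"
  assumes "B ** A = mat 1"
  shows "matrix_inv A = B"
proof -
  have r: "A ** B = mat 1" using assms matrix_left_right_inverse by blast
  have "A ** matrix_inv A = mat 1 \<and> matrix_inv A ** A = mat 1"
    unfolding matrix_inv_def by (rule someI[of _ B]) (use assms r in simp)
  then show ?thesis
    by (metis assms matrix_mul_assoc matrix_mul_lid matrix_mul_rid)
qed

text \<open>The inverse of \<open>cayley\<close> sends the block column (1, -i) to (1, 0), so the
  combinations A - iB and C - iD see only the left block column of \<open>U\<close>. Writing -i as a
  left matrix factor lets associativity carry it past right multiplications.\<close>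

lemma f_of_eq: "f_of U = (1 / sqrt 2) *\<^sub>R (block11 U + block21 U)" (is ?f)
  and h_of_eq: "h_of U = (1 / sqrt 2) *\<^sub>R (mat (- \<i>) ** (block11 U - block21 U))" (is ?h)
proof -
  have eq: "symplectic_of U = cayley ** block_mat (block11 U) (block12 U) (block21 U) (block22 U) **
      block_mat (mat (1/2)) (mat (\<i>/2)) (mat (1/2)) (mat (- \<i>/2))"
    by (simp only: symplectic_of_def block_mat_blocks matrix_inv_cayley)
  show ?f ?h
    unfolding f_of_def h_of_def eq cayley_def block_mat_mult blocks_block_mat mat_mult_left mat_mult_right
    by (simp_all add: vec_eq_iff scaleR_conv_of_real[where 'a=complex] field_simps)
qed

lemma bounded_linear_f_of: "bounded_linear f_of" and bounded_linear_h_of: "bounded_linear h_of"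
  unfolding linear_conv_bounded_linear[symmetric]
  by (auto intro!: linearI simp: f_of_eq h_of_eq mat_mult_left vec_eq_iff block11_def block21_def algebra_simps)

text \<open>The left block column of \<open>U ** M\<close> mixes both block columns of
  \<open>U\<close>; conjugation symmetry identifies the contribution of the right one with the
  conjugate of \<open>f_of U\<close>.\<close>

lemma f_of_mult:
  assumes "conj_symmetric U"
  shows "f_of (U ** M) = f_of U ** block11 M + map_matrix cnj (f_of U) ** block21 M"
proof -
  note b = bounded_bilinear_matrix_mult
  have "map_matrix cnj (f_of U) = (1 / sqrt 2) *\<^sub>R (block12 U + block22 U)"
    using assms by (auto simp: f_of_eq conj_symmetric_def vec_eq_iff)
  then show ?thesis
    by (simp add: f_of_eq blocks_mult bounded_bilinear.scaleR_left[OF b]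
        bounded_bilinear.add_left[OF b] algebra_simps)
qed

lemma h_of_mult:
  assumes "conj_symmetric U"
  shows "h_of (U ** M) = h_of U ** block11 M + map_matrix cnj (h_of U) ** block21 M"
proof -
  note b = bounded_bilinear_matrix_mult
  \<comment> \<open>Conjugation changes the sign of -i and also interchanges the roles of the two
    blocks in the difference, so the two signs cancel.\<close>
  have "map_matrix cnj (h_of U) = (1 / sqrt 2) *\<^sub>R (mat (- \<i>) ** (block12 U - block22 U))"
    using assms by (auto simp: h_of_eq conj_symmetric_def vec_eq_iff mat_mult_left algebra_simps)
  moreover have "block11 (U ** M) - block21 (U ** M) =
      (block11 U - block21 U) ** block11 M + (block12 U - block22 U) ** block21 M"
    by (simp add: blocks_mult bounded_bilinear.diff_left[OF b] algebra_simps)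
  ultimately show ?thesis
    by (simp only: h_of_eq bounded_bilinear.scaleR_left[OF b] matrix_mul_assoc[symmetric]
        bounded_bilinear.add_right[OF b] scaleR_add_right)
qed

lemma charges_eq:
  "charges g e F H = (\<chi> i. complex_of_real (g $ i)) v* H - (\<chi> i. complex_of_real (e $ i)) v* F"
  by (simp add: charges_def vec_eq_iff vector_matrix_mult_def sum_subtractf mult.commute)

subsection \<open>The Maurer-Cartan form\<close>

lemma dform_bounded_linear:
  "bounded_linear l \<Longrightarrow> U differentiable (at x) \<Longrightarrow> dform (\<lambda>y. l (U y)) x v = l (dform U x v)"
  unfolding dform_def by (rule frechet_derivative_bounded_linear)

text \<open>The composite with \<open>l\<close> vanishes near \<open>x\<close>, so its derivative is
  0; by linearity this derivative is also \<open>l\<close> of the derivative of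
  \<open>U\<close>.\<close>

lemma dform_in_kernel:
  assumes "bounded_linear l" "U differentiable (at x)" "open S" "x \<in> S" "\<And>y. y \<in> S \<Longrightarrow> l (U y) = 0"
  shows "l (dform U x v) = 0"
proof -
  have "((\<lambda>y. l (U y)) has_derivative (\<lambda>v. 0)) (at x)"
    by (rule has_derivative_transform_within_open[OF has_derivative_const assms(3,4)]) (simp add: assms(5))
  then show ?thesis
    using dform_bounded_linear[OF assms(1,2), of v] frechet_derivative_at[of _ "\<lambda>v. 0"]
    unfolding dform_def by metis
qed

lemma conj_symmetric_dform:
  fixes U :: "'d::real_normed_vector \<Rightarrow> complex^('n::finite + 'n)^('n + 'n)"
  assumes "U differentiable (at x)" "open S" "x \<in> S" "\<And>y. y \<in> S \<Longrightarrow> conj_symmetric (U y)"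
  shows "conj_symmetric (dform U x v)"
proof -
  \<comment> \<open>The relations are encoded as kernels of maps that are linear over the reals
    only, because of the conjugation; this suffices for real derivatives.\<close>
  let ?l = "\<lambda>M :: complex^('n + 'n)^('n + 'n). block12 M - map_matrix cnj (block21 M)"
  let ?l' = "\<lambda>M :: complex^('n + 'n)^('n + 'n). block22 M - map_matrix cnj (block11 M)"
  have "bounded_linear ?l" "bounded_linear ?l'"
    unfolding linear_conv_bounded_linear[symmetric]
    by (auto intro!: linearI simp: vec_eq_iff block11_def block12_def block21_def block22_def algebra_simps)
  from this[THEN dform_in_kernel[OF _ assms(1-3)]] show ?thesis
    using assms(4) by (simp add: conj_symmetric_def)
qed

text \<open>The product rule applied to the constant function
  \<open>symplectic_adjoint (U y) ** U y\<close>.\<close>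

lemma symplectic_adjoint_dform:
  assumes U: "U differentiable (at x)" and S: "open S" "x \<in> S"
    and inv: "\<And>y. y \<in> S \<Longrightarrow> symplectic_adjoint (U y) ** U y = mat 1"
  shows "symplectic_adjoint (dform U x v) ** U x = - (symplectic_adjoint (U x) ** dform U x v)"
proof -
  have dU: "(U has_derivative dform U x) (at x)"
    using U by (simp add: dform_def[abs_def] frechet_derivative_works)
  have "((\<lambda>y. symplectic_adjoint (U y) ** U y) has_derivative
      (\<lambda>v. symplectic_adjoint (U x) ** dform U x v + symplectic_adjoint (dform U x v) ** U x)) (at x)"
    by (rule bounded_bilinear.FDERIV[OF bounded_bilinear_matrix_mult
        bounded_linear.has_derivative[OF bounded_linear_symplectic_adjoint dU] dU])
  moreover have "((\<lambda>y. symplectic_adjoint (U y) ** U y) has_derivative (\<lambda>v. 0)) (at x)"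
    by (rule has_derivative_transform_within_open[OF has_derivative_const S]) (simp add: inv)
  ultimately have "(\<lambda>v. symplectic_adjoint (U x) ** dform U x v + symplectic_adjoint (dform U x v) ** U x)
      = (\<lambda>v. 0)"
    by (rule has_derivative_unique)
  then have "symplectic_adjoint (U x) ** dform U x v + symplectic_adjoint (dform U x v) ** U x = 0"
    by (rule fun_cong)
  then show ?thesis by (simp add: eq_neg_iff_add_eq_0 add.commute)
qed

lemma maurer_cartan_eq:
  "symplectic_adjoint (U x) ** U x = mat 1 \<Longrightarrow>
    maurer_cartan U x v = symplectic_adjoint (U x) ** dform U x v"
  by (simp add: maurer_cartan_def matrix_inv_eqI)

lemma mult_maurer_cartan:
  assumes "symplectic_adjoint (U x) ** U x = mat 1"
  shows "U x ** maurer_cartan U x v = dform U x v"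
proof -
  have "U x ** symplectic_adjoint (U x) = mat 1" using assms matrix_left_right_inverse by blast
  then show ?thesis by (simp add: maurer_cartan_eq[of U x, OF assms] matrix_mul_assoc)
qed

text \<open>The adjoint reverses the product defining \<Gamma>, and
  \<open>symplectic_adjoint_dform\<close> turns the result into -\<Gamma>. The lower left block of
  this relation is the symmetry.\<close>

lemma transpose_block21_maurer_cartan:
  fixes U :: "'d::real_normed_vector \<Rightarrow> complex^('n::finite + 'n)^('n + 'n)"
  assumes U: "U differentiable (at x)" and S: "open S" "x \<in> S"
    and inv: "\<And>y. y \<in> S \<Longrightarrow> symplectic_adjoint (U y) ** U y = mat 1"
  shows "transpose (block21 (maurer_cartan U x v)) = block21 (maurer_cartan U x v)"
proof -
  let ?\<Gamma> = "maurer_cartan U x v"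
  have "symplectic_adjoint ?\<Gamma> = - ?\<Gamma>"
    using symplectic_adjoint_dform[OF assms, of v]
    by (simp add: maurer_cartan_eq[of U x, OF inv[OF S(2)]] symplectic_adjoint_mult)
  then have "- transpose (block21 ?\<Gamma>) = block21 (- ?\<Gamma>)"
    by (metis symplectic_adjoint_def blocks_block_mat(3))
  then show ?thesis by (simp add: block21_def transpose_def vec_eq_iff)
qed

text \<open>With the inverse of \<open>U\<close> written as its adjoint, d\<Gamma> has a
  second-derivative part, which drops out under antisymmetrization, and a part quadratic in dU,
  which is cancelled by \<Gamma> \<and> \<Gamma>.\<close>

lemma maurer_cartan_equation:
  fixes U :: "'d::real_normed_vector \<Rightarrow> complex^('n::finite + 'n)^('n + 'n)"
  assumes S: "open S" "x \<in> S" and U: "Ck_on 2 S U"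
    and inv: "\<And>y. y \<in> S \<Longrightarrow> symplectic_adjoint (U y) ** U y = mat 1"
  shows "ext_deriv (maurer_cartan U) x v w + wedge (maurer_cartan U) (maurer_cartan U) x v w = 0"
proof -
  let ?D = "dform U x" and ?adj = "symplectic_adjoint" and ?\<Gamma> = "maurer_cartan U"
  let ?D2 = "\<lambda>v w. dform (\<lambda>z. dform U z w) x v"
  have diff: "U differentiable (at x)" and diff2: "(\<lambda>z. dform U z w) differentiable (at x)" for w
    using U S(2) by (simp_all add: numeral_2_eq_2 dform_def)
  have dU: "(U has_derivative ?D) (at x)"
    using diff by (simp add: dform_def[abs_def] frechet_derivative_works)
  have ddU: "((\<lambda>z. dform U z w) has_derivative (\<lambda>v. ?D2 v w)) (at x)" for w
    using diff2[of w] unfolding frechet_derivative_works by (simp add: dform_def[abs_def])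
  have d\<Gamma>: "dform (\<lambda>z. ?\<Gamma> z w) x v = ?adj (U x) ** ?D2 v w + ?adj (?D v) ** ?D w" for v w
  proof -
    have "((\<lambda>z. ?adj (U z) ** dform U z w) has_derivative
        (\<lambda>v. ?adj (U x) ** ?D2 v w + ?adj (?D v) ** ?D w)) (at x)"
      by (rule bounded_bilinear.FDERIV[OF bounded_bilinear_matrix_mult
        bounded_linear.has_derivative[OF bounded_linear_symplectic_adjoint dU] ddU])
    \<comment> \<open>The adjoint agrees with \<open>matrix_inv\<close> on all of \<open>S\<close>,
      hence near \<open>x\<close>, so the derivatives coincide.\<close>
    then have "((\<lambda>z. ?\<Gamma> z w) has_derivative
        (\<lambda>v. ?adj (U x) ** ?D2 v w + ?adj (?D v) ** ?D w)) (at x)"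
      by (rule has_derivative_transform_within_open[OF _ S]) (simp add: maurer_cartan_eq inv)
    from frechet_derivative_at[OF this] show ?thesis
      unfolding dform_def by (rule fun_cong[symmetric])
  qed
  have "?\<Gamma> x v ** ?\<Gamma> x w = - (?adj (?D v) ** ?D w)" for v w
  proof -
    have "?\<Gamma> x v ** ?\<Gamma> x w = - (?adj (?D v) ** U x) ** ?\<Gamma> x w"
      using symplectic_adjoint_dform[OF diff S inv, of v] S(2) by (simp add: maurer_cartan_eq inv)
    also have "\<dots> = - (?adj (?D v) ** (U x ** ?\<Gamma> x w))"
      by (simp add: mult_uminus_left matrix_mul_assoc)
    also have "\<dots> = - (?adj (?D v) ** ?D w)"
      using S(2) by (simp add: mult_maurer_cartan inv)
    finally show ?thesis .
  qed
  moreover have "?D2 v w = ?D2 w v"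
    unfolding dform_def by (rule second_derivative_symmetric[OF S(1) U S(2)])
  ultimately show ?thesis
    by (simp add: ext_deriv_def wedge_def d\<Gamma>)
qed

subsection \<open>Smoothness of the embedded coset representative\<close>

text \<open>Smoothness of \<open>L\<close> and of \<rho> is known in charts of the group only. On
  the open set \<open>S\<close> of parameters that \<open>L\<close> sends into one chart domain
  around \<open>L x\<close>, the composite factors through that chart and
  \<open>Ck_on_compose\<close> applies.\<close>

lemma coset_representative_Usp:
  fixes \<A> :: "('g, 'e::real_inner) atlas" and L :: "'d::real_inner \<Rightarrow> 'g"
    and \<rho> :: "'g \<Rightarrow> complex^('n::finite + 'n)^('n + 'n)"
  assumes emb: "coset_embedding G T \<A> H \<kk> \<rho>" and rep: "coset_representative G T \<A> H V \<phi> L"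
    and x: "x \<in> \<phi> ` V"
  obtains S where "open S" "x \<in> S" "Ck_on k S (\<lambda>y. \<rho> (L y))" "\<And>y. y \<in> S \<Longrightarrow> \<rho> (L y) \<in> Usp"
proof -
  let ?W = "\<phi> ` V"
  have T: "topspace T = carrier G" and man: "smooth_manifold T \<A>"
    and hom: "\<rho> \<in> hom G Usp_group" and \<rho>: "smooth_to_vec T \<A> (carrier G) \<rho>"
    using emb by (auto simp: coset_embedding_def lie_group_def)
  have W: "open ?W" and L: "smooth_from_vec ?W T \<A> L"
    using rep by (auto simp: coset_representative_def)
  have cont: "continuous_map (top_of_set ?W) T L"
    using L by (simp add: smooth_map_def)
  have carrier: "L y \<in> carrier G" if "y \<in> ?W" for y
    using continuous_map_funspace[OF cont] that T by auto
  obtain D c where Dc: "(D, c) \<in> \<A>" "L x \<in> D"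
  proof -
    have "L x \<in> (\<Union>(D, c)\<in>\<A>. D)"
      using man carrier[OF x] T by (simp add: smooth_manifold_def)
    then show thesis using that by auto
  qed
  have D: "openin T D" "open (c ` D)" and hom_c: "homeomorphic_map (subtopology T D) (top_of_set (c ` D)) c"
    using man Dc(1) by (auto simp: smooth_manifold_def)
  have sub: "D \<subseteq> carrier G" using D(1) T openin_subset by blast
  have inj: "inj_on c D"
    using homeomorphic_imp_injective_map[OF hom_c] sub T by (simp add: Int_absorb1)
  define S where "S = ?W \<inter> L -` D"
  have "openin (top_of_set ?W) {y \<in> topspace (top_of_set ?W). L y \<in> D}"
    by (rule openin_continuous_map_preimage[OF cont D(1)])
  moreover have "{y \<in> topspace (top_of_set ?W). L y \<in> D} = S" by (auto simp: S_def)
  ultimately have S: "open S" using W openin_open_eq by metis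
  \<comment> \<open>The parameter space has the single chart (\<open>UNIV\<close>,
    \<open>id\<close>), so smoothness of \<open>L\<close> is read off in the group chart
    (\<open>D\<close>, \<open>c\<close>) alone.\<close>
  have "Ck_on k (id ` (UNIV \<inter> ?W \<inter> L -` D)) (c \<circ> L \<circ> inv_into UNIV id)"
    using L Dc(1) unfolding smooth_map_def smooth_on_def std_atlas_def by fast
  then have 1: "Ck_on k S (\<lambda>y. c (L y))"
    by (simp add: S_def o_def inv_id[unfolded id_def] id_def)
  have "Ck_on k (c ` (D \<inter> carrier G \<inter> \<rho> -` UNIV)) (id \<circ> \<rho> \<circ> inv_into D c)"
    using \<rho> Dc(1) unfolding smooth_map_def smooth_on_def std_atlas_def by fast
  then have 2: "Ck_on k (c ` D) (\<lambda>u. \<rho> (inv_into D c u))"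
    using sub by (simp add: Int_absorb2 o_def)
  have "Ck_on k S (\<lambda>y. \<rho> (inv_into D c (c (L y))))"
    by (rule Ck_on_compose[OF _ S D(2) _ 1 2]) (use man in \<open>auto simp: S_def smooth_manifold_def\<close>)
  then have "Ck_on k S (\<lambda>y. \<rho> (L y))"
    by (rule Ck_on_cong[OF S, rotated]) (simp add: S_def inj)
  moreover have "\<rho> (L y) \<in> Usp" if "y \<in> S" for y
    using hom carrier that by (auto simp: hom_def Usp_group_def S_def)
  moreover have "x \<in> S" using x Dc(2) by (simp add: S_def)
  ultimately show thesis using that S by blast
qed

subsection \<open>Charges\<close>

text \<open>The signs of the two antisymmetric factors cancel and the diagonal vanishes, so every
  unordered pair is counted twice. This is the origin of the factors 1/2.\<close>

lemma sum_antisym_ext: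
  "(\<Sum>C=1..N. \<Sum>D=1..N. antisym_ext X C D * antisym_ext Y C D) =
    2 * (\<Sum>(C, D)\<in>{(C, D). 1 \<le> C \<and> C < D \<and> D \<le> N}. X C D * Y C D)"
proof -
  let ?g = "\<lambda>C D. if C < D then X C D * Y C D else 0"
  have "(\<Sum>C=1..N. \<Sum>D=1..N. antisym_ext X C D * antisym_ext Y C D) =
      (\<Sum>C=1..N. \<Sum>D=1..N. ?g C D + ?g D C)"
    by (intro sum.cong) (auto simp: antisym_ext_def)
  also have "\<dots> = (\<Sum>C=1..N. \<Sum>D=1..N. ?g C D) + (\<Sum>C=1..N. \<Sum>D=1..N. ?g D C)"
    by (simp add: sum.distrib)
  also have "(\<Sum>C=1..N. \<Sum>D=1..N. ?g D C) = (\<Sum>C=1..N. \<Sum>D=1..N. ?g C D)"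
    by (rule sum.swap)
  also have "(\<Sum>C=1..N. \<Sum>D=1..N. ?g C D) = (\<Sum>(C, D)\<in>{1..N} \<times> {1..N}. ?g C D)"
    by (rule sum.cartesian_product)
  also have "\<dots> = (\<Sum>(C, D)\<in>{(C, D). 1 \<le> C \<and> C < D \<and> D \<le> N}. X C D * Y C D)"
    by (rule sum.mono_neutral_cong_right) (auto split: if_splits)
  finally show ?thesis by simp
qed

lemma sum_col_labels:
  fixes col :: "nat \<times> nat + nat \<Rightarrow> 'n::finite"
  assumes "bij_betw col (col_labels N m) UNIV"
  shows "(\<Sum>k\<in>UNIV. X k * Y k) = (\<Sum>I=1..m. X (col (Inr I)) * Y (col (Inr I))) +
    1/2 * (\<Sum>C=1..N. \<Sum>D=1..N. antisym_ext (\<lambda>A B. X (col (Inl (A, B)))) C D *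
                              antisym_ext (\<lambda>A B. Y (col (Inl (A, B)))) C D)"
proof -
  let ?P = "{(A, B). 1 \<le> A \<and> A < B \<and> B \<le> N}"
  have fin: "finite ?P" by (rule finite_subset[of _ "{1..N} \<times> {1..N}"]) auto
  have "(\<Sum>k\<in>UNIV. X k * Y k) = (\<Sum>l\<in>col_labels N m. X (col l) * Y (col l))"
    by (rule sum.reindex_bij_betw[OF assms, symmetric])
  also have "\<dots> = (\<Sum>l\<in>Inl ` ?P. X (col l) * Y (col l)) + (\<Sum>l\<in>Inr ` {1..m}. X (col l) * Y (col l))"
    unfolding col_labels_def by (rule sum.union_disjoint) (use fin in auto)
  also have "(\<Sum>l\<in>Inl ` ?P. X (col l) * Y (col l)) = (\<Sum>(A, B)\<in>?P. X (col (Inl (A, B))) * Y (col (Inl (A, B))))"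
    by (subst sum.reindex) (auto simp: case_prod_beta)
  also have "(\<Sum>l\<in>Inr ` {1..m}. X (col l) * Y (col l)) = (\<Sum>I=1..m. X (col (Inr I)) * Y (col (Inr I)))"
    by (subst sum.reindex) auto
  finally show ?thesis unfolding sum_antisym_ext by (simp add: add.commute)
qed

lemma cnj_row_pair: "cnj (row_pair col Z A B) = antisym_ext (\<lambda>A B. cnj (Z $ col (Inl (A, B)))) A B"
  by (simp add: row_pair_def antisym_ext_def)

text \<open>The product sums over the row index of \<open>P\<close>, whereas in
  \<open>mat_pair_pair col P A B C D\<close> the free pair labels the row; symmetry of
  \<open>P\<close> exchanges the two.\<close>

lemma row_pair_mult_symmetric:
  fixes col :: "nat \<times> nat + nat \<Rightarrow> 'n::finite" and Z :: "complex^'n"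
  assumes "bij_betw col (col_labels N m) UNIV" and P: "transpose P = P"
  shows "row_pair col ((\<chi> k. cnj (Z $ k)) v* P) A B =
    (\<Sum>I=1..m. cnj (row_single col Z I) * mat_single_pair col P I A B)
    + 1/2 * (\<Sum>C=1..N. \<Sum>D=1..N. cnj (row_pair col Z C D) * mat_pair_pair col P A B C D)"
proof -
  have sym: "P $ k $ l = P $ l $ k" for k l using P by (metis transpose_def vec_lambda_beta)
  have "((\<chi> k. cnj (Z $ k)) v* P) $ k = (\<Sum>I=1..m. cnj (row_single col Z I) * row_single col (P $ k) I) +
      1/2 * (\<Sum>C=1..N. \<Sum>D=1..N. cnj (row_pair col Z C D) * row_pair col (P $ k) C D)" for k
    using sum_col_labels[OF assms(1), of "\<lambda>l. cnj (Z $ l)" "\<lambda>l. P $ k $ l"]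
    by (simp add: vector_matrix_mult_def cnj_row_pair row_pair_def[of col "P $ k"] row_single_def sym[of _ k] mult.commute)
  note entry = this
  \<comment> \<open>In the sum over single columns the claim has the summed label first, so symmetry
    is applied once more to match \<open>entry\<close>.\<close>
  show ?thesis
    unfolding row_pair_def[of col "_ v* _"] mat_pair_pair_def mat_single_pair_def row_pair_def[of col "P $ col (Inr _)"]
      antisym_ext_def[of _ A B] entry
    by (simp add: row_single_def sym[of "col (Inr _)"] sum_negf)
qed

text \<open>The summed label is the row index of \<open>P\<close> on both sides, so the contraction
  splits directly by \<open>sum_col_labels\<close>.\<close>

lemma row_single_mult:
  fixes col :: "nat \<times> nat + nat \<Rightarrow> 'n::finite" and Z :: "complex^'n"
  assumes "bij_betw col (col_labels N m) UNIV"
  shows "row_single col ((\<chi> k. cnj (Z $ k)) v* P) I =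
    1/2 * (\<Sum>A=1..N. \<Sum>B=1..N. cnj (row_pair col Z A B) * mat_pair_single col P A B I)
    + (\<Sum>J=1..m. cnj (row_single col Z J) * mat_single_single col P J I)"
  using sum_col_labels[OF assms, of "\<lambda>l. cnj (Z $ l)" "\<lambda>l. P $ l $ col (Inr I)"]
  by (simp add: vector_matrix_mult_def cnj_row_pair row_single_def mat_single_single_def mat_pair_single_def
      mult.commute add.commute)

lemma vector_matrix_mult_add_right: "x v* (A + B) = x v* A + x v* (B :: complex^'p^'n::finite)"
  by (simp add: vec_eq_iff vector_matrix_mult_def sum.distrib algebra_simps)

text \<open>For constant \<open>g\<close> and \<open>e\<close> the charges are a real linear
  function of \<open>U\<close>, so their derivative is the same function of dU = U \<Gamma>. The
  part containing \<omega> is what the covariant derivative subtracts.\<close>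

lemma cov_deriv_charges:
  fixes U :: "'d::real_normed_vector \<Rightarrow> complex^('n::finite + 'n)^('n + 'n)" and g e :: "real^'n"
  assumes U: "U differentiable (at x)" and sym: "conj_symmetric (U x)"
    and \<Gamma>: "U x ** \<Gamma> = dform U x v" and \<omega>: "\<omega> x v = block11 \<Gamma>"
  defines "Z \<equiv> \<lambda>y. charges g e (f_of (U y)) (h_of (U y))"
  shows "cov_deriv_row \<omega> Z x v = (\<chi> k. cnj (Z x $ k)) v* block21 \<Gamma>"
proof -
  have l: "bounded_linear (\<lambda>M. charges g e (f_of M) (h_of M))"
    unfolding linear_conv_bounded_linear[symmetric]
    by (rule linearI) (simp_all add: charges_def vec_eq_iff f_of_eq h_of_eq mat_mult_left block11_def block21_def
      sum_subtractf sum.distrib scaleR_sum_right algebra_simps)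
  let ?F = "map_matrix cnj (f_of (U x))" and ?H = "map_matrix cnj (h_of (U x))"
  have "dform Z x v = charges g e (f_of (dform U x v)) (h_of (dform U x v))"
    unfolding Z_def by (rule dform_bounded_linear[OF l U])
  also have "\<dots> = charges g e (f_of (U x) ** \<omega> x v + ?F ** block21 \<Gamma>) (h_of (U x) ** \<omega> x v + ?H ** block21 \<Gamma>)"
    by (simp add: \<Gamma>[symmetric] \<omega> f_of_mult[OF sym] h_of_mult[OF sym])
  also have "\<dots> = Z x v* \<omega> x v + charges g e ?F ?H v* block21 \<Gamma>"
    by (simp add: Z_def charges_eq vector_matrix_mul_assoc vector_matrix_mult_add_right algebra_simps)
  \<comment> \<open>Here it matters that \<open>g\<close> and \<open>e\<close> are real: conjugating
    the charges conjugates only \<open>f\<close> and \<open>h\<close>.\<close>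
  also have "charges g e ?F ?H = (\<chi> k. cnj (Z x $ k))"
    by (simp add: charges_def Z_def vec_eq_iff)
  finally show ?thesis by (simp add: cov_deriv_row_def)
qed

theorem mainTheorem1:
  fixes N m :: nat
    and col :: "nat \<times> nat + nat \<Rightarrow> 'n::finite"
    and G :: "('g, 'b) monoid_scheme" and T :: "'g topology" and \<A> :: "('g, 'e::real_inner) atlas"
    and H :: "'g set" and \<kk> :: "(('g \<Rightarrow> real) \<Rightarrow> real) set"
    and \<rho> :: "'g \<Rightarrow> complex^('n + 'n)^('n + 'n)"
    and V :: "'g set set" and \<phi> :: "'g set \<Rightarrow> 'd::real_inner" and L :: "'d \<Rightarrow> 'g"
    and U :: "'d \<Rightarrow> complex^('n + 'n)^('n + 'n)"
    and f h :: "'d \<Rightarrow> complex^'n^'n"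
    and \<Gamma> :: "'d \<Rightarrow> 'd \<Rightarrow> complex^('n + 'n)^('n + 'n)"
    and \<omega> P :: "'d \<Rightarrow> 'd \<Rightarrow> complex^'n^'n"
  assumes "N \<ge> 3" and "CARD('n) = N * (N - 1) div 2 + m"
    and "bij_betw col (col_labels N m) UNIV"
    and "coset_embedding G T \<A> H \<kk> \<rho>"
    and "coset_representative G T \<A> H V \<phi> L"
    and U_eq: "U = (\<lambda>x. \<rho> (L x))"
    and f_eq: "f = (\<lambda>x. f_of (U x))" and h_eq: "h = (\<lambda>x. h_of (U x))"
    and \<Gamma>_eq: "\<Gamma> = maurer_cartan U"
    and \<omega>_eq: "\<omega> = (\<lambda>x v. block11 (\<Gamma> x v))" and P_eq: "P = (\<lambda>x v. block21 (\<Gamma> x v))"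
    and "\<forall>x\<in>\<phi> ` V. \<forall>v. label_block_diagonal N m col (\<omega> x v)"
  shows "\<forall>x\<in>\<phi> ` V.
      (\<forall>v. \<Gamma> x v = block_mat (\<omega> x v) (map_matrix cnj (P x v)) (P x v) (map_matrix cnj (\<omega> x v))) \<and>
      (\<forall>v w. ext_deriv \<Gamma> x v w + wedge \<Gamma> \<Gamma> x v w = 0) \<and>
      (\<forall>v. cov_deriv_mat \<omega> f x v = map_matrix cnj (f x) ** P x v) \<and>
      (\<forall>v. cov_deriv_mat \<omega> h x v = map_matrix cnj (h x) ** P x v) \<and>
      (\<forall>g e :: real^'n. let Z = (\<lambda>y. charges g e (f y) (h y)) in
         (\<forall>v. \<forall>A\<in>{1..N}. \<forall>B\<in>{1..N}.
            row_pair col (cov_deriv_row \<omega> Z x v) A B =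
              (\<Sum>I=1..m. cnj (row_single col (Z x) I) * mat_single_pair col (P x v) I A B)
              + 1/2 * (\<Sum>C=1..N. \<Sum>D=1..N.
                  cnj (row_pair col (Z x) C D) * mat_pair_pair col (P x v) A B C D)) \<and>
         (\<forall>v. \<forall>I\<in>{1..m}.
            row_single col (cov_deriv_row \<omega> Z x v) I =
              1/2 * (\<Sum>A=1..N. \<Sum>B=1..N.
                  cnj (row_pair col (Z x) A B) * mat_pair_single col (P x v) A B I)
              + (\<Sum>J=1..m. cnj (row_single col (Z x) J) * mat_single_single col (P x v) J I)))"
proof (intro ballI)
  fix x assume "x \<in> \<phi> ` V"
  \<comment> \<open>Order 2 is enough: \<Gamma> contains first derivatives of \<open>U\<close>, and
    d\<Gamma> second ones.\<close>
  then obtain S where S: "open S" "x \<in> S" and U: "Ck_on 2 S U" and Usp: "\<And>y. y \<in> S \<Longrightarrow> U y \<in> Usp"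
    unfolding U_eq using coset_representative_Usp[OF assms(4,5)] by metis
  note inv = symplectic_adjoint_Usp[OF Usp]
  have diff: "U differentiable (at x)" using U S(2) by (simp add: numeral_2_eq_2)
  have U\<Gamma>: "U x ** \<Gamma> x v = dform U x v" for v
    unfolding \<Gamma>_eq by (rule mult_maurer_cartan[of U x, OF inv[OF S(2)]])
  have symU: "conj_symmetric (U x)" by (rule conj_symmetric_Usp[OF Usp[OF S(2)]])
  have "conj_symmetric (\<Gamma> x v)" for v
    unfolding \<Gamma>_eq maurer_cartan_eq[of U x, OF inv[OF S(2)]]
    by (intro conj_symmetric_mult conj_symmetric_symplectic_adjoint symU
        conj_symmetric_dform[OF diff S] conj_symmetric_Usp Usp)
  then have blocks: "\<Gamma> x v = block_mat (\<omega> x v) (map_matrix cnj (P x v)) (P x v) (map_matrix cnj (\<omega> x v))" for v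
    by (subst block_mat_blocks[of "\<Gamma> x v", symmetric]) (simp add: conj_symmetric_def \<omega>_eq P_eq)
  have flat: "ext_deriv \<Gamma> x v w + wedge \<Gamma> \<Gamma> x v w = 0" for v w
    unfolding \<Gamma>_eq by (rule maurer_cartan_equation[OF S U inv])
  have df: "cov_deriv_mat \<omega> f x v = map_matrix cnj (f x) ** P x v" for v
    by (simp add: cov_deriv_mat_def f_eq dform_bounded_linear[OF bounded_linear_f_of diff]
        U\<Gamma>[symmetric] f_of_mult[OF symU] \<omega>_eq P_eq)
  have dh: "cov_deriv_mat \<omega> h x v = map_matrix cnj (h x) ** P x v" for v
    by (simp add: cov_deriv_mat_def h_eq dform_bounded_linear[OF bounded_linear_h_of diff]
        U\<Gamma>[symmetric] h_of_mult[OF symU] \<omega>_eq P_eq)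
  \<comment> \<open>The charge identities in matrix form; the column labels enter only when this
    product is expanded in the last step.\<close>
  have dZ: "cov_deriv_row \<omega> (\<lambda>y. charges g e (f y) (h y)) x v =
      (\<chi> k. cnj (charges g e (f x) (h x) $ k)) v* P x v" for g e v
    unfolding f_eq h_eq P_eq by (rule cov_deriv_charges[OF diff symU U\<Gamma>]) (simp add: \<omega>_eq)
  have symP: "transpose (P x v) = P x v" for v
    unfolding P_eq \<Gamma>_eq by (rule transpose_block21_maurer_cartan[OF diff S inv])
  show "(\<forall>v. \<Gamma> x v = block_mat (\<omega> x v) (map_matrix cnj (P x v)) (P x v) (map_matrix cnj (\<omega> x v))) \<and>
      (\<forall>v w. ext_deriv \<Gamma> x v w + wedge \<Gamma> \<Gamma> x v w = 0) \<and>
      (\<forall>v. cov_deriv_mat \<omega> f x v = map_matrix cnj (f x) ** P x v) \<and>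
      (\<forall>v. cov_deriv_mat \<omega> h x v = map_matrix cnj (h x) ** P x v) \<and>
      (\<forall>g e :: real^'n. let Z = (\<lambda>y. charges g e (f y) (h y)) in
         (\<forall>v. \<forall>A\<in>{1..N}. \<forall>B\<in>{1..N}.
            row_pair col (cov_deriv_row \<omega> Z x v) A B =
              (\<Sum>I=1..m. cnj (row_single col (Z x) I) * mat_single_pair col (P x v) I A B)
              + 1/2 * (\<Sum>C=1..N. \<Sum>D=1..N.
                  cnj (row_pair col (Z x) C D) * mat_pair_pair col (P x v) A B C D)) \<and>
         (\<forall>v. \<forall>I\<in>{1..m}.
            row_single col (cov_deriv_row \<omega> Z x v) I =
              1/2 * (\<Sum>A=1..N. \<Sum>B=1..N.
                  cnj (row_pair col (Z x) A B) * mat_pair_single col (P x v) A B I)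
              + (\<Sum>J=1..m. cnj (row_single col (Z x) J) * mat_single_single col (P x v) J I)))"
    unfolding Let_def dZ
    by (intro conjI allI ballI blocks flat df dh row_pair_mult_symmetric[OF assms(3) symP]
        row_single_mult[OF assms(3)])
qed

end
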